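(* Let $n\geq 2$ and let $Y$ be a graph on the vertex set $[n]$. Let $n_1,\ldots,n_r$ denote the sizes (numbers of vertices) of the connected components of $\overline Y$, and let $\nu=\gcd(n_1,\ldots,n_r)$. For each toric acyclic orientation $[\alpha]_{\sim}\in\operatorname{Acyc}(\overline Y)/{\sim}$, choose a linear extension $\sigma_{[\alpha]_{\sim}}$ of $[\alpha]_{\sim}$, and let $J_{[\alpha]_{\sim}}$ be the connected component of $\mathsf{FS}(\mathsf{Cycle}_n,Y)$ containing $\sigma_{[\alpha]_{\sim}}$. Then the graphs $J_{[\alpha]_{\sim}},\varphi^*(J_{[\alpha]_{\sim}}),\ldots,(\varphi^* )^{\nu-1}(J_{[\alpha]_{\sim}})$ are distinct, pairwise isomorphic connected components of $\mathsf{FS}(\mathsf{Cycle}_n,Y)$. Moreover, \[\mathsf{FS}(\mathsf{Cycle}_n,Y)=\bigoplus_{[\alpha]_{\sim}\in\operatorname{Acyc}(\overline Y)/\sim}\ \bigoplus_{k=0}^{\nu-1}(\varphi^* )^k(J_{[\alpha]_{\sim}}),\] where $\bigoplus$ denotes disjoint union of graphs.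
   Context: All graphs are finite and simple; $[n]=\{1,\ldots,n\}$; $\overline Y$ is the complement of $Y$. For graphs $X,Y$ with $|V(X)|=|V(Y)|$, the friends-and-strangers graph $\mathsf{FS}(X,Y)$ has as vertices all bijections $\sigma\colon V(X)\to V(Y)$; two bijections $\sigma,\sigma'$ are adjacent iff there is an edge $\{a,b\}\in E(X)$ with $\{\sigma(a),\sigma(b)\}\in E(Y)$, $\sigma(a)=\sigma'(b)$, $\sigma(b)=\sigma'(a)$, and $\sigma(c)=\sigma'(c)$ for all $c\in V(X)\setminus\{a,b\}$. When $V(X)=V(Y)=[n]$, the vertices are the permutations in $\mathfrak S_n$. $\mathsf{Cycle}_n$ is the graph with vertex set $[n]$ and edge set $\{\{i,i+1\}:1\le i\le n-1\}\cup\{\{n,1\}\}$. For a graph $G$ with vertex set $[n]$, $\operatorname{Acyc}(G)$ is the set of acyclic orientations of $G$. For $\alpha\in\operatorname{Acyc}(G)$, $\leq_\alpha$ is the partial order on $[n]$ with $i\leq_\alpha j$ iff $\alpha$ contains a directed path (possibly of length $0$) from $i$ to $j$. $\mathcal L(\alpha)$ is the set of linear extensions of $([n],\leq_\alpha)$, i.e., permutations $\sigma\in\mathfrak S_n$ such that $\sigma^{-1}(a)\leq\sigma^{-1}(b)$ whenever $a\leq_\alpha b$. A source (sink) of $\alpha$ is a vertex of in-degree (out-degree) $0$. A flip reverses the directions of all edges incident to a vertex that is a source or a sink. Write $\alpha\sim\alpha'$ if $\alpha'$ can be obtained from $\alpha$ by a sequence of flips; the classes $[\alpha]_\sim$ in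 $\operatorname{Acyc}(G)/{\sim}$ are called toric acyclic orientations. A linear extension of $[\alpha]_\sim$ is a permutation $\sigma$ such that $\sigma\in\mathcal L(\widehat\alpha)$ for some $\widehat\alpha\in[\alpha]_\sim$. Let $\varphi\colon[n]\to[n]$ be the cyclic permutation $\varphi(i)=i+1 \pmod n$, and define $\varphi^*\colon\mathfrak S_n\to\mathfrak S_n$ by $\varphi^*(\sigma)=\sigma\circ\varphi$. For an induced subgraph $H$ of $\mathsf{FS}(\mathsf{Cycle}_n,Y)$, $\varphi^*(H)$ is the induced subgraph of $\mathsf{FS}(\mathsf{Cycle}_n,Y)$ on the vertex set $\varphi^*(V(H))$. *)

theory Defs
  imports
    "Graph_Theory.Digraph_Isomorphism"
    "HOL-Library.FuncSet"
    "HOL-Library.Disjoint_Sets"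
begin

text \<open>
  As in the Graph_Theory library, a finite simple graph is a finite symmetric loop-free
  digraph without parallel arcs (\<^locale>\<open>pair_graph\<close>): the edge \<open>{u, v}\<close> is
  represented by the two arcs \<open>(u, v)\<close> and \<open>(v, u)\<close>.
\<close>

definition complement_graph :: "'a pair_pre_digraph \<Rightarrow> 'a pair_pre_digraph" where
  "complement_graph Y = \<lparr> pverts = pverts Y,
     parcs = {(u, v). u \<in> pverts Y \<and> v \<in> pverts Y \<and> u \<noteq> v \<and> (u, v) \<notin> parcs Y} \<rparr>"

definition cycle_graph :: "nat \<Rightarrow> nat pair_pre_digraph" where
  "cycle_graph n = \<lparr> pverts = {1..n},
     parcs = {(u, v). {u, v} \<in> {{i, i + 1} | i. 1 \<le> i \<and> i \<le> n - 1} \<union> {{n, 1}}} \<rparr>"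

definition conn_components :: "('a, 'b) pre_digraph \<Rightarrow> ('a, 'b) pre_digraph set" where
  "conn_components G = {H. pre_digraph.max_subgraph G connected H}"

definition component_of :: "('a, 'b) pre_digraph \<Rightarrow> 'a \<Rightarrow> ('a, 'b) pre_digraph" where
  "component_of G v = (THE H. H \<in> conn_components G \<and> v \<in> verts H)"

text \<open>Internal disjoint union: the members of the family have pairwise disjoint vertex
  sets (for distinct indices), and their union, in vertices and in arcs, is all of \<open>G\<close>.\<close>

definition is_disjoint_union ::
    "('a, 'b) pre_digraph \<Rightarrow> 'i set \<Rightarrow> ('i \<Rightarrow> ('a, 'b) pre_digraph) \<Rightarrow> bool" where
  "is_disjoint_union G I F \<longleftrightarrow>
     disjoint_family_on (\<lambda>i. verts (F i)) I \<and> G = pre_digraph.Union G (F ` I)"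


subsection \<open>Friends-and-strangers graphs\<close>

text \<open>A bijection \<open>A \<rightarrow> B\<close> is an extensional function (equal to \<^const>\<open>undefined\<close>
  outside \<open>A\<close>), so that distinct HOL functions are distinct bijections.\<close>

definition bijections :: "'a set \<Rightarrow> 'b set \<Rightarrow> ('a \<Rightarrow> 'b) set" where
  "bijections A B = {\<sigma> \<in> A \<rightarrow>\<^sub>E B. bij_betw \<sigma> A B}"

definition FS :: "'a pair_pre_digraph \<Rightarrow> 'b pair_pre_digraph \<Rightarrow> ('a \<Rightarrow> 'b) pair_pre_digraph" where
  "FS X Y = \<lparr> pverts = bijections (pverts X) (pverts Y),
     parcs = {(\<sigma>, \<sigma>').
       \<sigma> \<in> bijections (pverts X) (pverts Y) \<and> \<sigma>' \<in> bijections (pverts X) (pverts Y) \<and>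
       (\<exists>a b. (a, b) \<in> parcs X \<and> (\<sigma> a, \<sigma> b) \<in> parcs Y \<and> \<sigma> a = \<sigma>' b \<and> \<sigma> b = \<sigma>' a \<and>
          (\<forall>c \<in> pverts X - {a, b}. \<sigma> c = \<sigma>' c))} \<rparr>"

abbreviation FS_cycle :: "nat \<Rightarrow> nat pair_pre_digraph \<Rightarrow> (nat \<Rightarrow> nat, (nat \<Rightarrow> nat) \<times> (nat \<Rightarrow> nat)) pre_digraph" where
  "FS_cycle n Y \<equiv> with_proj (FS (cycle_graph n) Y)"

definition cyc_perm :: "nat \<Rightarrow> nat \<Rightarrow> nat" where
  "cyc_perm n i = (if i = n then 1 else i + 1)"

definition cyc_shift :: "nat \<Rightarrow> (nat \<Rightarrow> nat) \<Rightarrow> (nat \<Rightarrow> nat)" where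
  "cyc_shift n \<sigma> = compose {1..n} \<sigma> (cyc_perm n)"

definition cyc_shift_graph :: "nat \<Rightarrow> nat pair_pre_digraph \<Rightarrow>
    (nat \<Rightarrow> nat, (nat \<Rightarrow> nat) \<times> (nat \<Rightarrow> nat)) pre_digraph \<Rightarrow>
    (nat \<Rightarrow> nat, (nat \<Rightarrow> nat) \<times> (nat \<Rightarrow> nat)) pre_digraph" where
  "cyc_shift_graph n Y H = FS_cycle n Y \<restriction> (cyc_shift n ` verts H)"


subsection \<open>Toric acyclic orientations\<close>

definition orientation :: "'a pair_pre_digraph \<Rightarrow> 'a pair_pre_digraph \<Rightarrow> bool" where
  "orientation G \<alpha> \<longleftrightarrow> pverts \<alpha> = pverts G \<and> parcs \<alpha> \<subseteq> parcs G \<and>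
     (\<forall>(u, v) \<in> parcs G. (u, v) \<in> parcs \<alpha> \<longleftrightarrow> (v, u) \<notin> parcs \<alpha>)"

definition Acyc :: "'a pair_pre_digraph \<Rightarrow> 'a pair_pre_digraph set" where
  "Acyc G = {\<alpha>. orientation G \<alpha> \<and> acyclic (parcs \<alpha>)}"

definition flip :: "'a \<Rightarrow> 'a pair_pre_digraph \<Rightarrow> 'a pair_pre_digraph" where
  "flip v \<alpha> = \<lparr> pverts = pverts \<alpha>,
     parcs = {(a, b). if v \<in> {a, b} then (b, a) \<in> parcs \<alpha> else (a, b) \<in> parcs \<alpha>} \<rparr>"

definition flip_rel :: "'a pair_pre_digraph rel" where
  "flip_rel = {(\<alpha>, flip v \<alpha>) | \<alpha> v. v \<in> pverts \<alpha> \<and>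
     (in_degree (with_proj \<alpha>) v = 0 \<or> out_degree (with_proj \<alpha>) v = 0)}"

definition toric_rel :: "'a pair_pre_digraph \<Rightarrow> 'a pair_pre_digraph rel" where
  "toric_rel G = {(\<alpha>, \<alpha>'). \<alpha> \<in> Acyc G \<and> \<alpha>' \<in> Acyc G \<and> (\<alpha>, \<alpha>') \<in> flip_rel\<^sup>*}"

definition toric_acyclic_orientations :: "'a pair_pre_digraph \<Rightarrow> 'a pair_pre_digraph set set" where
  "toric_acyclic_orientations G = Acyc G // toric_rel G"

definition linear_extensions :: "nat \<Rightarrow> nat pair_pre_digraph \<Rightarrow> (nat \<Rightarrow> nat) set" where
  "linear_extensions n \<alpha> = {\<sigma> \<in> bijections {1..n} {1..n}.
     \<forall>a b. a \<rightarrow>\<^sup>*\<^bsub>with_proj \<alpha>\<^esub> b \<longrightarrow> inv_into {1..n} \<sigma> a \<le> inv_into {1..n} \<sigma> b}"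

definition toric_linear_extensions :: "nat \<Rightarrow> nat pair_pre_digraph set \<Rightarrow> (nat \<Rightarrow> nat) set" where
  "toric_linear_extensions n T = (\<Union>\<alpha> \<in> T. linear_extensions n \<alpha>)"

end

theory Submission
  imports Defs
begin

text \<open>
  Read a bijection \<open>\<sigma>\<close> as an arrangement of the people \<open>1, \<dots>, n\<close> on the seats of a cycle, cut
  between seats \<open>n\<close> and \<open>1\<close>.  Two people who are adjacent in the complement \<open>G\<close> of \<open>Y\<close> are not
  friends and never swap.  The seats induce an acyclic orientation \<open>orient \<sigma>\<close> of \<open>G\<close>, pointing
  from the lower to the higher seat, and \<open>\<sigma>\<close> is a linear extension of \<open>\<alpha>\<close> exactly when
  \<open>orient \<sigma> = \<alpha>\<close>.  Write \<open>\<sigma> \<frown> \<tau>\<close> when the two arrangements lie in one component, and let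
  \<open>shift\<close> be \<open>\<phi>\<^sup>*\<close>.  The theorem then rests on two facts.

  Components up to rotation are toric acyclic orientations (\<open>flip_equiv_iff_joined_shift\<close>).
  Swaps that do not use the edge across the cut keep the orientation, and bubble sort shows that
  two arrangements with the same orientation are joined by such swaps (\<open>sort_by_key\<close>,
  \<open>same_orientation_joined\<close>).  A rotation takes the first person, a source, to the last
  seat, which is a flip.  Conversely every source can first be sorted to seat \<open>1\<close>, so every flip
  is realised by sorting and rotating.  A swap across the cut becomes an ordinary swap after one
  rotation, so it does not change the toric class either.

  The rotations that fix a component are the multiples of \<open>\<nu>\<close>.  If \<open>C\<close> is the vertex set of a
  component of \<open>G\<close>, sort \<open>C\<close> to the front and rotate it to the back: no edge of \<open>G\<close> leaves \<open>C\<close>, so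
  the orientation is unchanged and \<open>|C|\<close> is a period (\<open>component_rotation_joined\<close>).  The
  periods are the multiples of the least one, hence \<open>\<nu>\<close> is a period (\<open>component_gcd_period\<close>).
  Conversely, lift a walk from \<open>\<sigma>\<close> to its rotation by \<open>k\<close> to integer positions.  Each swap keeps
  the sum of the positions.  Neighbours in \<open>G\<close> never pass each other, so they have equal winding
  numbers; the winding numbers \<open>w v\<close> are therefore constant on the components of \<open>G\<close>, and
  comparing sums gives \<open>k = (\<Sum>v. w v)\<close>, a multiple of \<open>\<nu>\<close> (\<open>component_gcd_dvd_period\<close>).

  Finally \<open>shift\<close> is an automorphism of the graph of arrangements, so it permutes the components
  and restricts to isomorphisms between them.
\<close>

section \<open>Connected components of symmetric digraphs\<close>

lemma (in wf_digraph) strongly_connected_imp_connected: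
  assumes "strongly_connected G"
  shows "connected G"
  using assms reachable_mk_symmetricI
  by (auto simp: connected_def strongly_connected_def mk_symmetric_def)

lemma (in sym_digraph) connected_subgraph_reachable:
  assumes "subgraph H G" "connected H" "u \<in> verts H" "v \<in> verts H"
  shows "u \<rightarrow>\<^sup>* v"
proof -
  have "u \<rightarrow>\<^sup>*\<^bsub>with_proj (mk_symmetric H)\<^esub> v"
    using assms by (auto simp: connected_def strongly_connected_def mk_symmetric_def)
  moreover have "subgraph (with_proj (mk_symmetric H)) (with_proj (mk_symmetric G))"
    using assms(1) by (rule subgraph_mk_symmetric)
  ultimately have "u \<rightarrow>\<^sup>*\<^bsub>with_proj (mk_symmetric G)\<^esub> v"
    by (rule pre_digraph.reachable_mono)
  then show ?thesis
    by (simp add: reachable_mk_symmetric_eq[OF sym_arcs])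
qed

text \<open>
  A connected subgraph containing \<open>v\<close> cannot leave the reachability class of \<open>v\<close>, and the class
  is induced, so it already contains every arc that such a subgraph could have.
\<close>

lemma (in sym_digraph) reachable_class_in_conn_components:
  assumes "v \<in> verts G"
  shows "G \<restriction> {w. v \<rightarrow>\<^sup>* w} \<in> conn_components G"
proof -
  let ?K = "G \<restriction> {w. v \<rightarrow>\<^sup>* w}"
  have sub: "subgraph ?K G"
    by (rule subgraph_induce_subgraphI) (auto dest: reachable_in_verts)
  interpret K: wf_digraph ?K by (rule wellformed_induce_subgraph)
  have "connected ?K"
    using induce_reachable_is_in_sccs[OF assms]
    by (intro K.strongly_connected_imp_connected) auto
  moreover have "H' = ?K" if "subgraph ?K H'" "subgraph H' G" "connected H'" for H'
  proof -
    have "verts ?K \<subseteq> verts H'" using that(1) by (rule subgraph_imp_subverts)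
    then have "v \<in> verts H'" using assms by auto
    then have "verts H' \<subseteq> verts ?K"
      using connected_subgraph_reachable[OF that(2,3)] by auto
    with \<open>verts ?K \<subseteq> verts H'\<close> have verts: "verts H' = verts ?K" by blast
    have "arcs H' \<subseteq> arcs ?K"
    proof
      fix e assume e: "e \<in> arcs H'"
      interpret H': wf_digraph H' using that(2) by auto
      have "tail G e \<in> verts H'" "head G e \<in> verts H'" "e \<in> arcs G"
        using e that(2) H'.wellformed[OF e] by (auto simp: compatible_def)
      then show "e \<in> arcs ?K" using verts by auto
    qed
    moreover have "arcs ?K \<subseteq> arcs H'" using that(1) by blast
    ultimately show ?thesis
      using verts that by (intro pre_digraph.equality) (auto simp: compatible_def)
  qed
  ultimately show ?thesis
    using sub by (auto simp: conn_components_def max_subgraph_def)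
qed

text \<open>
  A maximal connected subgraph lies inside the reachability class of any of its vertices, and
  that class is itself connected; maximality makes the two equal.
\<close>

lemma (in sym_digraph) conn_components_eq_reachable_classes:
  "conn_components G = {G \<restriction> {w. v \<rightarrow>\<^sup>* w} | v. v \<in> verts G}"
proof (intro equalityI subsetI)
  fix H assume "H \<in> conn_components G"
  then have H: "max_subgraph connected H"
    by (simp add: conn_components_def)
  then have sub: "subgraph H G" and con: "connected H"
    by (auto simp: max_subgraph_def)
  then obtain v where v: "v \<in> verts H"
    by (auto simp: connected_def strongly_connected_def mk_symmetric_def)
  let ?K = "G \<restriction> {w. v \<rightarrow>\<^sup>* w}"
  have vG: "v \<in> verts G" using sub v by auto
  have "verts H \<subseteq> {w. v \<rightarrow>\<^sup>* w}"
    using connected_subgraph_reachable[OF sub con v] by auto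
  moreover interpret H: wf_digraph H using sub by auto
  have "subgraph H (G \<restriction> verts H)"
    using sub by (rule subgraph_induce_subgraphI2)
  moreover have "subgraph (G \<restriction> verts H) ?K"
    using calculation by (intro subgraphI) (auto simp: compatible_def)
  ultimately have "subgraph H ?K"
    by (rule_tac subgraph_trans)
  moreover have "max_subgraph connected ?K"
    using reachable_class_in_conn_components[OF vG] by (simp add: conn_components_def)
  ultimately have "H = ?K"
    using H by (intro max_subgraph_subg_eq)
  then show "H \<in> {G \<restriction> {w. v \<rightarrow>\<^sup>* w} | v. v \<in> verts G}"
    using vG by blast
qed (auto intro: reachable_class_in_conn_components)

lemma (in sym_digraph) component_of_eq:
  assumes "v \<in> verts G"
  shows "component_of G v = G \<restriction> {w. v \<rightarrow>\<^sup>* w}"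
  unfolding component_of_def
proof (rule the_equality)
  show "G \<restriction> {w. v \<rightarrow>\<^sup>* w} \<in> conn_components G \<and> v \<in> verts (G \<restriction> {w. v \<rightarrow>\<^sup>* w})"
    using assms reachable_class_in_conn_components by simp
next
  fix H assume "H \<in> conn_components G \<and> v \<in> verts H"
  then obtain u where H: "H = G \<restriction> {w. u \<rightarrow>\<^sup>* w}" and "u \<rightarrow>\<^sup>* v"
    by (auto simp: conn_components_eq_reachable_classes)
  then have "{w. u \<rightarrow>\<^sup>* w} = {w. v \<rightarrow>\<^sup>* w}"
    by (auto dest: symmetric_reachable' intro: reachable_trans)
  then show "H = G \<restriction> {w. v \<rightarrow>\<^sup>* w}" using H by simp
qed

section \<open>Friends walking on a cycle\<close>

locale friends_on_cycle =
  fixes n :: nat and Y :: "nat pair_pre_digraph"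
  assumes n_ge_2: "n \<ge> 2"
    and Y_graph: "pair_graph Y"
    and Y_verts_eq: "pverts Y = {1..n}"
begin

sublocale Y: pair_graph Y
  by (rule Y_graph)

abbreviation G :: "nat pair_pre_digraph" where
  "G \<equiv> complement_graph Y"

definition V :: "nat set" where
  "V = {1..n}"

lemma in_V_iff: "i \<in> V \<longleftrightarrow> 1 \<le> i \<and> i \<le> n"
  by (simp add: V_def)

lemma finite_V [simp]: "finite V"
  by (simp add: V_def)

abbreviation B :: "(nat \<Rightarrow> nat) set" where
  "B \<equiv> bijections V V"

abbreviation next_pos :: "nat \<Rightarrow> nat" where
  "next_pos \<equiv> cyc_perm n"

abbreviation shift :: "(nat \<Rightarrow> nat) \<Rightarrow> nat \<Rightarrow> nat" where
  "shift \<equiv> cyc_shift n"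

abbreviation joined :: "(nat \<Rightarrow> nat) \<Rightarrow> (nat \<Rightarrow> nat) \<Rightarrow> bool" (infix "\<frown>" 50) where
  "\<sigma> \<frown> \<tau> \<equiv> \<sigma> \<rightarrow>\<^sup>*\<^bsub>FS_cycle n Y\<^esub> \<tau>"

definition pos :: "(nat \<Rightarrow> nat) \<Rightarrow> nat \<Rightarrow> nat" where
  "pos \<sigma> v = inv_into V \<sigma> v"

text \<open>
  Indexing the edges of the cycle by their first seat treats the edge across the cut like all others.
\<close>

definition exchange :: "nat \<Rightarrow> (nat \<Rightarrow> nat) \<Rightarrow> nat \<Rightarrow> nat" where
  "exchange i \<sigma> = \<sigma>(i := \<sigma> (next_pos i), next_pos i := \<sigma> i)"

lemma Y_verts: "pverts Y = V"
  by (simp add: V_def Y_verts_eq)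

lemma G_arc_iff: "(u, v) \<in> parcs G \<longleftrightarrow> u \<in> V \<and> v \<in> V \<and> u \<noteq> v \<and> (u, v) \<notin> parcs Y"
  by (simp add: complement_graph_def Y_verts)

lemma G_verts: "pverts G = V"
  by (simp add: complement_graph_def Y_verts)

lemma Y_sym: "(u, v) \<in> parcs Y \<Longrightarrow> (v, u) \<in> parcs Y"
  by (rule Y.arcs_symmetric)

lemma Y_irrefl: "(u, v) \<in> parcs Y \<Longrightarrow> u \<noteq> v"
  by (rule Y.no_loops')

lemma G_sym: "(u, v) \<in> parcs G \<Longrightarrow> (v, u) \<in> parcs G"
  using Y_sym by (auto simp: G_arc_iff)

lemma
  assumes "\<sigma> \<in> B"
  shows value_in_V: "i \<in> V \<Longrightarrow> \<sigma> i \<in> V"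
    and pos_in_V: "v \<in> V \<Longrightarrow> pos \<sigma> v \<in> V"
    and value_pos: "v \<in> V \<Longrightarrow> \<sigma> (pos \<sigma> v) = v"
    and pos_value: "i \<in> V \<Longrightarrow> pos \<sigma> (\<sigma> i) = i"
    and value_outside: "i \<notin> V \<Longrightarrow> \<sigma> i = undefined"
proof -
  have b: "bij_betw \<sigma> V V" and e: "\<sigma> \<in> V \<rightarrow>\<^sub>E V"
    using assms by (auto simp: bijections_def)
  show "i \<in> V \<Longrightarrow> \<sigma> i \<in> V" and "i \<notin> V \<Longrightarrow> \<sigma> i = undefined"
    using e by (auto simp: PiE_def extensional_def)
  show "v \<in> V \<Longrightarrow> pos \<sigma> v \<in> V" "v \<in> V \<Longrightarrow> \<sigma> (pos \<sigma> v) = v"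
    using b unfolding pos_def by (metis bij_betw_imp_surj_on inv_into_into, metis bij_betw_inv_into_right)
  show "i \<in> V \<Longrightarrow> pos \<sigma> (\<sigma> i) = i"
    using b unfolding pos_def by (rule bij_betw_inv_into_left)
qed

lemma value_eq_iff:
  "\<sigma> \<in> B \<Longrightarrow> i \<in> V \<Longrightarrow> j \<in> V \<Longrightarrow> \<sigma> i = \<sigma> j \<longleftrightarrow> i = j"
  by (metis pos_value)

lemma pos_eq_iff:
  "\<sigma> \<in> B \<Longrightarrow> u \<in> V \<Longrightarrow> v \<in> V \<Longrightarrow> pos \<sigma> u = pos \<sigma> v \<longleftrightarrow> u = v"
  by (metis value_pos)

lemma bijectionsI:
  assumes "\<And>i. i \<in> V \<Longrightarrow> \<sigma> i \<in> V" "\<And>i. i \<notin> V \<Longrightarrow> \<sigma> i = undefined"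
    and "inj_on \<sigma> V"
  shows "\<sigma> \<in> B"
  using assms endo_inj_surj[of V \<sigma>]
  by (auto simp: bijections_def PiE_def extensional_def bij_betw_def image_subset_iff)

lemma bijection_eqI:
  assumes "\<sigma> \<in> B" "\<tau> \<in> B" "\<And>v. v \<in> V \<Longrightarrow> pos \<sigma> v = pos \<tau> v"
  shows "\<sigma> = \<tau>"
proof
  fix i show "\<sigma> i = \<tau> i"
  proof (cases "i \<in> V")
    case True
    then show ?thesis
      using value_pos[OF assms(2), of "\<sigma> i"] assms(3)[of "\<sigma> i"]
      by (simp add: pos_value value_in_V assms(1))
  next
    case False
    then show ?thesis using assms by (simp add: value_outside)
  qed
qed

lemma next_pos_in_V: "i \<in> V \<Longrightarrow> next_pos i \<in> V"
  using n_ge_2 by (auto simp: cyc_perm_def in_V_iff)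

lemma next_pos_neq: "i \<in> V \<Longrightarrow> next_pos i \<noteq> i"
  using n_ge_2 by (auto simp: cyc_perm_def in_V_iff)

lemma next_pos_eq_iff: "i \<in> V \<Longrightarrow> j \<in> V \<Longrightarrow> next_pos i = next_pos j \<longleftrightarrow> i = j"
  by (auto simp: cyc_perm_def in_V_iff)

lemma next_pos_surj: "j \<in> V \<Longrightarrow> \<exists>i \<in> V. next_pos i = j"
  using n_ge_2
  by (cases "j = 1")
    (auto simp: cyc_perm_def in_V_iff intro!: bexI[of _ n] bexI[of _ "j - 1"])

lemma exchange_in_B:
  assumes "\<sigma> \<in> B" "i \<in> V"
  shows "exchange i \<sigma> \<in> B"
proof (rule bijectionsI)
  fix j
  have next_V: "next_pos i \<in> V" by (rule next_pos_in_V[OF assms(2)])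
  show "j \<in> V \<Longrightarrow> exchange i \<sigma> j \<in> V" "j \<notin> V \<Longrightarrow> exchange i \<sigma> j = undefined"
    using assms next_V value_in_V[OF assms(1)] value_outside[OF assms(1)]
    by (auto simp: exchange_def)
  show "inj_on (exchange i \<sigma>) V"
    using assms next_V by (auto simp: inj_on_def exchange_def value_eq_iff)
qed

lemma pos_exchange:
  assumes "\<sigma> \<in> B" "i \<in> V" "v \<in> V"
  shows "pos (exchange i \<sigma>) v =
    (if pos \<sigma> v = i then next_pos i else if pos \<sigma> v = next_pos i then i else pos \<sigma> v)" (is "_ = ?p")
proof -
  have at_p: "exchange i \<sigma> ?p = v" and "?p \<in> V"
    using assms next_pos_in_V[OF assms(2)] next_pos_neq[OF assms(2)]
      value_pos[OF assms(1,3)] pos_in_V[OF assms(1,3)]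
    by (auto simp: exchange_def)
  from pos_value[OF exchange_in_B[OF assms(1,2)] this(2)]
  show ?thesis unfolding at_p .
qed

lemma cycle_verts: "pverts (cycle_graph n) = V"
  by (simp add: cycle_graph_def V_def)

lemma cycle_arc_iff:
  "(a, b) \<in> parcs (cycle_graph n) \<longleftrightarrow> (\<exists>i \<in> V. {a, b} = {i, next_pos i})"
proof -
  have "{{i, i + 1} | i. 1 \<le> i \<and> i \<le> n - 1} \<union> {{n, 1}} = (\<lambda>i. {i, next_pos i}) ` V"
    using n_ge_2 by (auto simp: cyc_perm_def image_iff V_def) (force)+
  then show ?thesis by (simp add: cycle_graph_def) blast
qed

lemma FS_arc_iff:
  "(\<sigma>, \<tau>) \<in> parcs (FS (cycle_graph n) Y) \<longleftrightarrow>
     \<sigma> \<in> B \<and> (\<exists>i \<in> V. (\<sigma> i, \<sigma> (next_pos i)) \<in> parcs Y \<and> \<tau> = exchange i \<sigma>)"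
proof
  assume "(\<sigma>, \<tau>) \<in> parcs (FS (cycle_graph n) Y)"
  then obtain a b where B: "\<sigma> \<in> B" "\<tau> \<in> B" and ab: "(a, b) \<in> parcs (cycle_graph n)"
    and Y: "(\<sigma> a, \<sigma> b) \<in> parcs Y" and sw: "\<sigma> a = \<tau> b" "\<sigma> b = \<tau> a"
    and rest: "\<forall>c \<in> V - {a, b}. \<sigma> c = \<tau> c"
    by (auto simp: FS_def cycle_verts Y_verts)
  from ab obtain i where i: "i \<in> V" and abi: "{a, b} = {i, next_pos i}"
    by (auto simp: cycle_arc_iff)
  have "(\<sigma> i, \<sigma> (next_pos i)) \<in> parcs Y"
    using abi Y Y_sym by (auto simp: doubleton_eq_iff)
  moreover have "\<tau> = exchange i \<sigma>"
  proof
    fix c show "\<tau> c = exchange i \<sigma> c"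
      using abi sw rest B by (cases "c \<in> V") (auto simp: exchange_def doubleton_eq_iff value_outside)
  qed
  ultimately show "\<sigma> \<in> B \<and> (\<exists>i \<in> V. (\<sigma> i, \<sigma> (next_pos i)) \<in> parcs Y \<and> \<tau> = exchange i \<sigma>)"
    using B i by blast
next
  assume "\<sigma> \<in> B \<and> (\<exists>i \<in> V. (\<sigma> i, \<sigma> (next_pos i)) \<in> parcs Y \<and> \<tau> = exchange i \<sigma>)"
  then obtain i where i: "\<sigma> \<in> B" "i \<in> V" "(\<sigma> i, \<sigma> (next_pos i)) \<in> parcs Y" "\<tau> = exchange i \<sigma>"
    by blast
  then have "(i, next_pos i) \<in> parcs (cycle_graph n)" by (auto simp: cycle_arc_iff)
  moreover have "\<sigma> i = \<tau> (next_pos i)" "\<sigma> (next_pos i) = \<tau> i"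
    "\<forall>c \<in> V - {i, next_pos i}. \<sigma> c = \<tau> c"
    using i next_pos_neq[of i] by (auto simp: exchange_def)
  ultimately have "\<exists>a b. (a, b) \<in> parcs (cycle_graph n) \<and> (\<sigma> a, \<sigma> b) \<in> parcs Y \<and>
      \<sigma> a = \<tau> b \<and> \<sigma> b = \<tau> a \<and> (\<forall>c \<in> V - {a, b}. \<sigma> c = \<tau> c)"
    using i(3) by blast
  then show "(\<sigma>, \<tau>) \<in> parcs (FS (cycle_graph n) Y)"
    using i exchange_in_B[of \<sigma> i] by (simp add: FS_def cycle_verts Y_verts)
qed

lemma FS_verts: "pverts (FS (cycle_graph n) Y) = B"
  by (simp add: FS_def cycle_verts Y_verts)

lemma exchange_exchange: "i \<in> V \<Longrightarrow> exchange i (exchange i \<sigma>) = \<sigma>"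
  by (auto simp: exchange_def next_pos_neq)

lemma FS_arc_sym:
  assumes "(\<sigma>, \<tau>) \<in> parcs (FS (cycle_graph n) Y)"
  shows "(\<tau>, \<sigma>) \<in> parcs (FS (cycle_graph n) Y)"
proof -
  from assms obtain i where i: "\<sigma> \<in> B" "i \<in> V" "(\<sigma> i, \<sigma> (next_pos i)) \<in> parcs Y" "\<tau> = exchange i \<sigma>"
    by (auto simp: FS_arc_iff)
  then have "(\<tau> i, \<tau> (next_pos i)) \<in> parcs Y"
    using Y_sym next_pos_neq[of i] by (auto simp: exchange_def)
  then show ?thesis
    using i exchange_in_B[of \<sigma> i] exchange_exchange[of i \<sigma>] by (auto simp: FS_arc_iff)
qed

sublocale FS: sym_digraph "FS_cycle n Y"
proof
  show "symmetric (FS_cycle n Y)"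
    using FS_arc_sym by (auto simp: symmetric_def intro: symI)
qed (auto simp: FS_verts FS_arc_iff exchange_in_B)

sublocale G: sym_digraph "with_proj G"
proof
  show "symmetric (with_proj G)"
    using G_sym by (auto simp: symmetric_def intro: symI)
qed (auto simp: G_verts G_arc_iff)

lemma joined_sym: "\<sigma> \<frown> \<tau> \<Longrightarrow> \<tau> \<frown> \<sigma>"
  by (rule FS.symmetric_reachable')

lemma joined_in_B: "\<sigma> \<frown> \<tau> \<Longrightarrow> \<sigma> \<in> B" "\<sigma> \<frown> \<tau> \<Longrightarrow> \<tau> \<in> B"
  using FS.reachable_in_verts by (simp_all add: FS_verts)

lemma joined_refl: "\<sigma> \<in> B \<Longrightarrow> \<sigma> \<frown> \<sigma>"
  using FS.reachable_refl by (simp add: FS_verts)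

lemma exchange_joined:
  assumes "\<sigma> \<in> B" "i \<in> V" "(\<sigma> i, \<sigma> (next_pos i)) \<in> parcs Y"
  shows "\<sigma> \<frown> exchange i \<sigma>"
proof (rule FS.reachable_adjI)
  show "\<sigma> \<rightarrow>\<^bsub>FS_cycle n Y\<^esub> exchange i \<sigma>"
    using assms by (simp add: FS_arc_iff) blast
qed

lemma joined_induct [consumes 1, case_names base step]:
  assumes "\<sigma> \<frown> \<tau>"
    and "\<sigma> \<in> B \<Longrightarrow> P \<sigma>"
    and "\<And>\<rho> i. \<sigma> \<frown> \<rho> \<Longrightarrow> \<rho> \<in> B \<Longrightarrow> i \<in> V \<Longrightarrow> (\<rho> i, \<rho> (next_pos i)) \<in> parcs Y \<Longrightarrow>
           P \<rho> \<Longrightarrow> P (exchange i \<rho>)"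
  shows "P \<tau>"
  using assms(1)
proof (induction rule: FS.reachable_induct)
  case base
  then show ?case using assms(2) by (simp add: FS_verts)
next
  case (step x y)
  then show ?case using assms(3) by (auto simp: FS_arc_iff)
qed

lemma shift_apply: "shift \<sigma> i = (if i \<in> V then \<sigma> (next_pos i) else undefined)"
  by (simp add: cyc_shift_def compose_def V_def)

lemma shift_in_B:
  assumes "\<sigma> \<in> B"
  shows "shift \<sigma> \<in> B"
proof (rule bijectionsI)
  show "inj_on (shift \<sigma>) V"
    using assms by (auto simp: inj_on_def shift_apply value_eq_iff next_pos_in_V next_pos_eq_iff)
qed (use assms in \<open>auto simp: shift_apply value_in_V next_pos_in_V\<close>)

lemma shift_pow_in_B: "\<sigma> \<in> B \<Longrightarrow> (shift ^^ k) \<sigma> \<in> B"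
  by (induction k) (auto intro: shift_in_B)

lemma pos_shift:
  assumes "\<sigma> \<in> B" "v \<in> V"
  shows "pos (shift \<sigma>) v = (if pos \<sigma> v = 1 then n else pos \<sigma> v - 1)"
proof -
  let ?i = "if pos \<sigma> v = 1 then n else pos \<sigma> v - 1"
  have "?i \<in> V" "next_pos ?i = pos \<sigma> v"
    using pos_in_V[OF assms] n_ge_2 by (auto simp: cyc_perm_def in_V_iff)
  then have "shift \<sigma> ?i = v"
    using assms by (simp add: shift_apply value_pos)
  then show ?thesis
    using pos_value[OF shift_in_B[OF assms(1)] \<open>?i \<in> V\<close>] by simp
qed

lemma pos_shift_pow:
  assumes "\<sigma> \<in> B" "v \<in> V" "k \<le> n"
  shows "pos ((shift ^^ k) \<sigma>) v = (if pos \<sigma> v \<le> k then pos \<sigma> v + n - k else pos \<sigma> v - k)"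
  using assms(3)
proof (induction k)
  case 0
  then show ?case using pos_in_V[OF assms(1,2)] by (simp add: in_V_iff)
next
  case (Suc k)
  then show ?case
    using pos_in_V[OF assms(1,2)] pos_shift[OF shift_pow_in_B[OF assms(1)] assms(2), of k] by (auto simp: in_V_iff)
qed

lemma shift_pow_n: "\<sigma> \<in> B \<Longrightarrow> (shift ^^ n) \<sigma> = \<sigma>"
  using pos_in_V by (intro bijection_eqI) (auto simp: shift_pow_in_B pos_shift_pow in_V_iff)

text \<open>
  Rotation commutes with swaps up to moving the swapped edge along the cycle; this is what makes
  \<open>shift\<close> a graph automorphism and what moves a swap across the cut away from the cut.
\<close>

lemma shift_exchange:
  assumes "j \<in> V"
  shows "shift (exchange (next_pos j) \<sigma>) = exchange j (shift \<sigma>)"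
  using assms next_pos_in_V[OF assms]
  by (auto simp: fun_eq_iff shift_apply exchange_def next_pos_eq_iff)

lemma FS_arc_shift:
  assumes "(\<sigma>, \<tau>) \<in> parcs (FS (cycle_graph n) Y)"
  shows "(shift \<sigma>, shift \<tau>) \<in> parcs (FS (cycle_graph n) Y)"
proof -
  from assms obtain i where i: "\<sigma> \<in> B" "i \<in> V" "(\<sigma> i, \<sigma> (next_pos i)) \<in> parcs Y" "\<tau> = exchange i \<sigma>"
    by (auto simp: FS_arc_iff)
  obtain j where j: "j \<in> V" "next_pos j = i"
    using next_pos_surj[OF i(2)] by blast
  then have "(shift \<sigma> j, shift \<sigma> (next_pos j)) \<in> parcs Y" "shift \<tau> = exchange j (shift \<sigma>)"
    using i shift_exchange[of j \<sigma>] by (auto simp: shift_apply)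
  then show ?thesis
    using j(1) shift_in_B[OF i(1)] by (auto simp: FS_arc_iff)
qed

lemma FS_arc_shift_pow:
  "(\<sigma>, \<tau>) \<in> parcs (FS (cycle_graph n) Y) \<Longrightarrow>
   ((shift ^^ k) \<sigma>, (shift ^^ k) \<tau>) \<in> parcs (FS (cycle_graph n) Y)"
  by (induction k) (auto intro: FS_arc_shift)

lemma shift_pow_inverse:
  assumes "\<sigma> \<in> B"
  shows "(shift ^^ (n - 1)) (shift \<sigma>) = \<sigma>"
proof -
  have "n = Suc (n - 1)" using n_ge_2 by simp
  then show ?thesis
    by (metis shift_pow_n[OF assms] funpow_Suc_right comp_apply)
qed

lemma FS_arc_shift_iff:
  assumes "\<sigma> \<in> B" "\<tau> \<in> B"
  shows "(shift \<sigma>, shift \<tau>) \<in> parcs (FS (cycle_graph n) Y) \<longleftrightarrow> (\<sigma>, \<tau>) \<in> parcs (FS (cycle_graph n) Y)"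
proof
  assume "(shift \<sigma>, shift \<tau>) \<in> parcs (FS (cycle_graph n) Y)"
  from FS_arc_shift_pow[OF this, of "n - 1"]
  show "(\<sigma>, \<tau>) \<in> parcs (FS (cycle_graph n) Y)"
    using assms by (simp only: shift_pow_inverse)
qed (rule FS_arc_shift)

lemma shift_inj_on: "inj_on shift B"
  by (rule inj_on_inverseI) (rule shift_pow_inverse)

lemma joined_shift: "\<sigma> \<frown> \<tau> \<Longrightarrow> shift \<sigma> \<frown> shift \<tau>"
proof (induction rule: FS.reachable_induct)
  case base
  then show ?case by (simp add: FS_verts shift_in_B)
next
  case (step x y)
  then show ?case
    by (metis FS.reachable_adj_trans FS_arc_shift with_proj_simps(3))
qed

lemma joined_shift_pow: "\<sigma> \<frown> \<tau> \<Longrightarrow> (shift ^^ k) \<sigma> \<frown> (shift ^^ k) \<tau>"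
  by (induction k) (simp_all add: joined_shift)

end

section \<open>Acyclic orientations and sorting\<close>

lemma down_closed_eq_initial_segment:
  fixes P :: "nat set"
  assumes "finite P" "0 \<notin> P" "\<And>i j. j \<in> P \<Longrightarrow> 1 \<le> i \<Longrightarrow> i \<le> j \<Longrightarrow> i \<in> P"
  shows "P = {1..card P}"
proof (cases "P = {}")
  case False
  have "P = {1..Max P}"
  proof (intro equalityI subsetI)
    fix i assume "i \<in> P"
    then show "i \<in> {1..Max P}" using assms(1,2) by (cases i) auto
  next
    fix i assume "i \<in> {1..Max P}"
    then show "i \<in> P" using assms(3)[of "Max P" i] Max_in[OF assms(1) False] by auto
  qed
  then show ?thesis by (metis card_atLeastAtMost diff_Suc_1)
qed simp

context friends_on_cycle
begin

text \<open>
  The acyclic orientation of which \<open>\<sigma>\<close> is a linear extension.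
\<close>

definition orient :: "(nat \<Rightarrow> nat) \<Rightarrow> nat pair_pre_digraph" where
  "orient \<sigma> = \<lparr> pverts = V, parcs = {(u, v). (u, v) \<in> parcs G \<and> pos \<sigma> u < pos \<sigma> v} \<rparr>"

lemma orient_verts: "pverts (orient \<sigma>) = V"
  by (simp add: orient_def)

lemma orient_arc_iff: "(u, v) \<in> parcs (orient \<sigma>) \<longleftrightarrow> (u, v) \<in> parcs G \<and> pos \<sigma> u < pos \<sigma> v"
  by (simp add: orient_def)

lemma orient_eq_iff:
  "orient \<sigma> = orient \<tau> \<longleftrightarrow>
     (\<forall>u v. (u, v) \<in> parcs G \<longrightarrow> (pos \<sigma> u < pos \<sigma> v \<longleftrightarrow> pos \<tau> u < pos \<tau> v))"
  by (auto simp: orient_def)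

text \<open>
  A swap that does not use the edge across the cut changes the relative order of only the two
  people who swap, and they are not adjacent in \<open>G\<close>.
\<close>

lemma exchange_interior:
  assumes \<sigma>: "\<sigma> \<in> B" and i: "1 \<le> i" "i < n" and not_G: "(\<sigma> i, \<sigma> (i + 1)) \<notin> parcs G"
  shows "\<sigma> \<frown> exchange i \<sigma>" and "orient (exchange i \<sigma>) = orient \<sigma>"
proof -
  have V: "i \<in> V" "i + 1 \<in> V" and next_i: "next_pos i = i + 1"
    using i by (auto simp: in_V_iff cyc_perm_def)
  have "(\<sigma> i, \<sigma> (i + 1)) \<in> parcs Y"
    using \<sigma> V not_G by (simp add: G_arc_iff value_in_V value_eq_iff)
  then show "\<sigma> \<frown> exchange i \<sigma>"
    using \<sigma> V next_i by (simp add: exchange_joined)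
  show "orient (exchange i \<sigma>) = orient \<sigma>"
    unfolding orient_eq_iff
  proof (intro allI impI)
    fix u v assume uv: "(u, v) \<in> parcs G"
    then have uvV: "u \<in> V" "v \<in> V" and "u \<noteq> v" by (auto simp: G_arc_iff)
    have "\<not> (pos \<sigma> u = i \<and> pos \<sigma> v = i + 1)" "\<not> (pos \<sigma> u = i + 1 \<and> pos \<sigma> v = i)"
      using uv not_G G_sym value_pos[OF \<sigma>] uvV by metis+
    moreover have "pos \<sigma> u \<noteq> pos \<sigma> v"
      using \<sigma> uvV \<open>u \<noteq> v\<close> by (simp add: pos_eq_iff)
    ultimately show "pos (exchange i \<sigma>) u < pos (exchange i \<sigma>) v \<longleftrightarrow> pos \<sigma> u < pos \<sigma> v"
      using \<sigma> V uvV by (auto simp: pos_exchange next_i)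
  qed
qed

text \<open>
  Bubble sort: whenever two neighbouring seats are in the wrong order with respect to the key,
  their occupants are not adjacent in \<open>G\<close>, since the key is monotone along the orientation.  So
  they may swap, which keeps the orientation and decreases the sum of \<open>f (\<sigma> i) * (n - i)\<close>.  All
  rearrangements below come from this lemma by a suitable choice of the key.
\<close>

lemma sort_by_key:
  fixes f :: "nat \<Rightarrow> nat"
  assumes "\<sigma> \<in> B"
    and "\<And>u v. (u, v) \<in> parcs (orient \<sigma>) \<Longrightarrow> f u \<le> f v"
  shows "\<exists>\<tau>. \<sigma> \<frown> \<tau> \<and> orient \<tau> = orient \<sigma> \<and>
    (\<forall>i j. 1 \<le> i \<longrightarrow> i \<le> j \<longrightarrow> j \<le> n \<longrightarrow> f (\<tau> i) \<le> f (\<tau> j))"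
  using assms
proof (induction "\<Sum>i \<in> V. f (\<sigma> i) * (n - i)" arbitrary: \<sigma> rule: less_induct)
  case less
  show ?case
  proof (cases "\<forall>i. 1 \<le> i \<longrightarrow> i < n \<longrightarrow> f (\<sigma> i) \<le> f (\<sigma> (i + 1))")
    case True
    have "f (\<sigma> i) \<le> f (\<sigma> j)" if "1 \<le> i" "i \<le> j" "j \<le> n" for i j
      using that(2,1,3)
    proof (induction j rule: dec_induct)
      case (step j)
      then show ?case using True by (metis Suc_eq_plus1 Suc_leD Suc_le_lessD le_trans)
    qed simp
    then show ?thesis using joined_refl[OF less.prems(1)] by blast
  next
    case False
    then obtain i where i: "1 \<le> i" "i < n" "f (\<sigma> (i + 1)) < f (\<sigma> i)"
      by (auto simp: not_le)
    let ?\<rho> = "exchange i \<sigma>"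
    have V: "i \<in> V" "i + 1 \<in> V" and next_i: "next_pos i = i + 1"
      using i by (auto simp: in_V_iff cyc_perm_def)
    have "(\<sigma> i, \<sigma> (i + 1)) \<notin> parcs G"
    proof
      assume "(\<sigma> i, \<sigma> (i + 1)) \<in> parcs G"
      then have "f (\<sigma> i) \<le> f (\<sigma> (i + 1))"
        using less.prems V by (intro less.prems(2)) (simp add: orient_arc_iff pos_value[OF less.prems(1)])
      then show False using i by simp
    qed
    note ex = exchange_interior[OF less.prems(1) i(1,2) this]
    have split: "(\<Sum>j \<in> V. g j) = g i + g (i + 1) + (\<Sum>j \<in> V - {i, i + 1}. g j)" for g :: "nat \<Rightarrow> nat"
    proof -
      have "V - {i, i + 1} = V - {i} - {i + 1}" by blast
      then show ?thesis
        using V sum.remove[of V i g] sum.remove[of "V - {i}" "i + 1" g] by simp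
    qed
    have "(\<Sum>j \<in> V - {i, i + 1}. f (?\<rho> j) * (n - j)) = (\<Sum>j \<in> V - {i, i + 1}. f (\<sigma> j) * (n - j))"
      by (intro sum.cong) (auto simp: exchange_def next_i)
    moreover have "f (?\<rho> i) * (n - i) + f (?\<rho> (i + 1)) * (n - (i + 1)) <
        f (\<sigma> i) * (n - i) + f (\<sigma> (i + 1)) * (n - (i + 1))"
    proof -
      obtain k where "n - i = Suc k" "n - (i + 1) = k"
        using i by (metis Suc_diff_Suc Suc_eq_plus1)
      then show ?thesis using i by (simp add: exchange_def next_i)
    qed
    ultimately have "(\<Sum>j \<in> V. f (?\<rho> j) * (n - j)) < (\<Sum>j \<in> V. f (\<sigma> j) * (n - j))"
      by (simp only: split[of "\<lambda>j. f (?\<rho> j) * (n - j)"] split[of "\<lambda>j. f (\<sigma> j) * (n - j)"])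
    from less.hyps[OF this exchange_in_B[OF less.prems(1) V(1)]]
    obtain \<tau> where "?\<rho> \<frown> \<tau>" "orient \<tau> = orient \<sigma>"
      "\<forall>i j. 1 \<le> i \<longrightarrow> i \<le> j \<longrightarrow> j \<le> n \<longrightarrow> f (\<tau> i) \<le> f (\<tau> j)"
      using ex(2) less.prems(2) by metis
    then show ?thesis
      using FS.reachable_trans[OF ex(1)] by blast
  qed
qed

text \<open>
  Take the position in \<open>\<tau>\<close> as the key: sorting by it turns \<open>\<sigma>\<close> into \<open>\<tau>\<close>.
\<close>

lemma same_orientation_joined:
  assumes "\<sigma> \<in> B" "\<tau> \<in> B" "orient \<sigma> = orient \<tau>"
  shows "\<sigma> \<frown> \<tau>"
proof -
  have "\<exists>\<rho>. \<sigma> \<frown> \<rho> \<and> orient \<rho> = orient \<sigma> \<and>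
      (\<forall>i j. 1 \<le> i \<longrightarrow> i \<le> j \<longrightarrow> j \<le> n \<longrightarrow> pos \<tau> (\<rho> i) \<le> pos \<tau> (\<rho> j))"
    using assms by (intro sort_by_key) (auto simp: orient_arc_iff)
  then obtain \<rho> where \<rho>: "\<sigma> \<frown> \<rho>"
    and mono: "\<And>i j. 1 \<le> i \<Longrightarrow> i \<le> j \<Longrightarrow> j \<le> n \<Longrightarrow> pos \<tau> (\<rho> i) \<le> pos \<tau> (\<rho> j)"
    by blast
  have \<rho>B: "\<rho> \<in> B" using joined_in_B(2)[OF \<rho>] .
  \<comment> \<open>\<open>g\<close> is an increasing permutation of \<open>V\<close>; hence \<open>i \<le> g i\<close>, and comparing sums gives \<open>g i = i\<close>\<close>
  define g where "g i = pos \<tau> (\<rho> i)" for i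
  have g_inj: "inj_on g V"
    unfolding g_def inj_on_def using \<rho>B assms(2) by (metis value_in_V pos_eq_iff value_eq_iff)
  have g_V: "g ` V = V"
    using g_inj \<rho>B assms(2) by (intro endo_inj_surj) (auto simp: g_def value_in_V pos_in_V)
  have ge: "i \<le> g i" if "1 \<le> i" "i \<le> n" for i
    using that
  proof (induction i rule: dec_induct)
    case base
    have "g 1 \<in> V" using g_V n_ge_2 by (auto simp: in_V_iff)
    then show ?case by (simp add: in_V_iff)
  next
    case (step i)
    have "g i \<noteq> g (Suc i)"
      using inj_onD[OF g_inj, of i "Suc i"] step.hyps step.prems by (auto simp: in_V_iff)
    moreover have "g i \<le> g (Suc i)" unfolding g_def using step by (intro mono) auto
    ultimately show ?case using step by simp
  qed
  have "sum g V = sum (\<lambda>i. i) V"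
    using sum.reindex[OF g_inj, of "\<lambda>i. i"] g_V by simp
  then have g_id: "i = g i" if "i \<in> V" for i
    using ge that by (intro sum_mono_inv[of "\<lambda>i. i" V g i]) (auto simp: in_V_iff)
  have "\<rho> = \<tau>"
    using \<rho>B assms(2) g_id by (intro bijection_eqI) (metis g_def value_pos pos_in_V)+
  then show ?thesis using \<rho> by simp
qed

lemma source_to_front:
  assumes "\<sigma> \<in> B" "v \<in> V" "\<And>u. (u, v) \<notin> parcs (orient \<sigma>)"
  shows "\<exists>\<tau>. \<sigma> \<frown> \<tau> \<and> orient \<tau> = orient \<sigma> \<and> \<tau> 1 = v"
proof -
  let ?f = "\<lambda>u. if u = v then 0 else 1 :: nat"
  have "\<exists>\<tau>. \<sigma> \<frown> \<tau> \<and> orient \<tau> = orient \<sigma> \<and>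
      (\<forall>i j. 1 \<le> i \<longrightarrow> i \<le> j \<longrightarrow> j \<le> n \<longrightarrow> ?f (\<tau> i) \<le> ?f (\<tau> j))"
    using assms by (intro sort_by_key) auto
  then obtain \<tau> where \<tau>: "\<sigma> \<frown> \<tau>" "orient \<tau> = orient \<sigma>"
    "\<And>i j. 1 \<le> i \<Longrightarrow> i \<le> j \<Longrightarrow> j \<le> n \<Longrightarrow> ?f (\<tau> i) \<le> ?f (\<tau> j)"
    by blast
  have "?f (\<tau> 1) \<le> ?f (\<tau> (pos \<tau> v))"
    using pos_in_V[OF joined_in_B(2)[OF \<tau>(1)] assms(2)] by (intro \<tau>(3)) (auto simp: in_V_iff)
  then have "\<tau> 1 = v"
    using value_pos[OF joined_in_B(2)[OF \<tau>(1)] assms(2)] by (simp split: if_splits)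
  then show ?thesis using \<tau> by blast
qed

lemma sink_to_back:
  assumes "\<sigma> \<in> B" "v \<in> V" "\<And>u. (v, u) \<notin> parcs (orient \<sigma>)"
  shows "\<exists>\<tau>. \<sigma> \<frown> \<tau> \<and> orient \<tau> = orient \<sigma> \<and> \<tau> n = v"
proof -
  let ?f = "\<lambda>u. if u = v then 1 else 0 :: nat"
  have "\<exists>\<tau>. \<sigma> \<frown> \<tau> \<and> orient \<tau> = orient \<sigma> \<and>
      (\<forall>i j. 1 \<le> i \<longrightarrow> i \<le> j \<longrightarrow> j \<le> n \<longrightarrow> ?f (\<tau> i) \<le> ?f (\<tau> j))"
    using assms by (intro sort_by_key) auto
  then obtain \<tau> where \<tau>: "\<sigma> \<frown> \<tau>" "orient \<tau> = orient \<sigma>"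
    "\<And>i j. 1 \<le> i \<Longrightarrow> i \<le> j \<Longrightarrow> j \<le> n \<Longrightarrow> ?f (\<tau> i) \<le> ?f (\<tau> j)"
    by blast
  have "?f (\<tau> (pos \<tau> v)) \<le> ?f (\<tau> n)"
    using pos_in_V[OF joined_in_B(2)[OF \<tau>(1)] assms(2)] by (intro \<tau>(3)) (auto simp: in_V_iff)
  then have "\<tau> n = v"
    using value_pos[OF joined_in_B(2)[OF \<tau>(1)] assms(2)] by (simp split: if_splits)
  then show ?thesis using \<tau> by blast
qed

text \<open>
  Sort \<open>C\<close> to the seats \<open>1, \<dots>, |C|\<close> and rotate by \<open>|C|\<close>.  The order inside \<open>C\<close> and the order
  outside \<open>C\<close> are kept, and no edge of \<open>G\<close> connects the two parts; hence the orientation is the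
  same as before.
\<close>

lemma component_rotation_joined:
  assumes \<sigma>: "\<sigma> \<in> B" and CV: "C \<subseteq> V"
    and closed: "\<And>u v. (u, v) \<in> parcs G \<Longrightarrow> u \<in> C \<longleftrightarrow> v \<in> C"
  shows "(shift ^^ card C) \<sigma> \<frown> \<sigma>"
proof -
  let ?m = "card C"
  let ?f = "\<lambda>u. if u \<in> C then 0 else 1 :: nat"
  have "\<exists>\<tau>. \<sigma> \<frown> \<tau> \<and> orient \<tau> = orient \<sigma> \<and>
      (\<forall>i j. 1 \<le> i \<longrightarrow> i \<le> j \<longrightarrow> j \<le> n \<longrightarrow> ?f (\<tau> i) \<le> ?f (\<tau> j))"
    using \<sigma> closed by (intro sort_by_key) (auto simp: orient_arc_iff)
  then obtain \<tau> where \<tau>: "\<sigma> \<frown> \<tau>" "orient \<tau> = orient \<sigma>"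
    and sorted: "\<And>i j. 1 \<le> i \<Longrightarrow> i \<le> j \<Longrightarrow> j \<le> n \<Longrightarrow> ?f (\<tau> i) \<le> ?f (\<tau> j)"
    by blast
  have \<tau>B: "\<tau> \<in> B" using joined_in_B(2)[OF \<tau>(1)] .
  let ?P = "pos \<tau> ` C"
  have "?P = {1..card ?P}"
  proof (rule down_closed_eq_initial_segment)
    show "finite ?P" using finite_subset[OF CV finite_V] by simp
    have "?P \<subseteq> V" using CV pos_in_V[OF \<tau>B] by blast
    then show "0 \<notin> ?P" by (auto simp: in_V_iff)
    fix i j assume j: "j \<in> ?P" and i: "1 \<le> i" "i \<le> j"
    then have jV: "j \<in> V" "\<tau> j \<in> C" using CV \<tau>B by (auto simp: pos_in_V value_pos subset_iff)
    with i sorted[of i j] have "\<tau> i \<in> C" by (auto simp: in_V_iff split: if_splits)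
    moreover have "pos \<tau> (\<tau> i) = i" using \<tau>B i jV by (intro pos_value) (auto simp: in_V_iff)
    ultimately show "i \<in> ?P" by force
  qed
  moreover have "inj_on (pos \<tau>) C"
    using CV \<tau>B by (auto simp: inj_on_def pos_eq_iff subset_iff)
  ultimately have P: "?P = {1..?m}" by (simp add: card_image)
  have C_iff: "v \<in> C \<longleftrightarrow> pos \<tau> v \<le> ?m" if "v \<in> V" for v
  proof
    assume "v \<in> C" then show "pos \<tau> v \<le> ?m" using P by auto
  next
    assume "pos \<tau> v \<le> ?m"
    then have "pos \<tau> v \<in> ?P" using P pos_in_V[OF \<tau>B that] by (auto simp: in_V_iff)
    then show "v \<in> C" using CV \<tau>B that by (auto simp: pos_eq_iff subset_iff)
  qed
  have m: "?m \<le> n" using card_mono[OF finite_V CV] by (simp add: V_def)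
  have "orient ((shift ^^ ?m) \<tau>) = orient \<tau>"
    unfolding orient_eq_iff
  proof (intro allI impI)
    fix u v assume uv: "(u, v) \<in> parcs G"
    then have uvV: "u \<in> V" "v \<in> V" by (auto simp: G_arc_iff)
    have "pos \<tau> u \<le> ?m \<longleftrightarrow> pos \<tau> v \<le> ?m" using closed[OF uv] C_iff uvV by auto
    moreover have "pos \<tau> u \<le> n" "pos \<tau> v \<le> n" using pos_in_V[OF \<tau>B] uvV by (auto simp: in_V_iff)
    ultimately show "pos ((shift ^^ ?m) \<tau>) u < pos ((shift ^^ ?m) \<tau>) v \<longleftrightarrow> pos \<tau> u < pos \<tau> v"
      using m uvV \<tau>B by (auto simp: pos_shift_pow)
  qed
  then have "(shift ^^ ?m) \<tau> \<frown> \<tau>"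
    using \<tau>B by (intro same_orientation_joined shift_pow_in_B)
  then show ?thesis
    using joined_shift_pow[OF \<tau>(1), of ?m] joined_sym[OF \<tau>(1)] FS.reachable_trans by blast
qed

end

section \<open>Flips and rotations\<close>

context friends_on_cycle
begin

text \<open>
  The first person moves behind everybody else and all other comparisons stay: a source is
  flipped into a sink.
\<close>

lemma orient_shift:
  assumes "\<sigma> \<in> B"
  shows "orient (shift \<sigma>) = flip (\<sigma> 1) (orient \<sigma>)"
proof -
  have V1: "1 \<in> V" using n_ge_2 by (simp add: in_V_iff)
  have "(u, v) \<in> parcs (orient (shift \<sigma>)) \<longleftrightarrow> (u, v) \<in> parcs (flip (\<sigma> 1) (orient \<sigma>))" for u v
  proof (cases "(u, v) \<in> parcs G")
    case True
    then have uv: "u \<in> V" "v \<in> V" "u \<noteq> v" "(v, u) \<in> parcs G"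
      using G_sym by (auto simp: G_arc_iff)
    have "pos \<sigma> u = 1 \<longleftrightarrow> u = \<sigma> 1" "pos \<sigma> v = 1 \<longleftrightarrow> v = \<sigma> 1"
      using uv assms V1 by (metis pos_value value_pos)+
    moreover have "1 \<le> pos \<sigma> u" "pos \<sigma> u \<le> n" "1 \<le> pos \<sigma> v" "pos \<sigma> v \<le> n" "pos \<sigma> u \<noteq> pos \<sigma> v"
      using uv assms pos_in_V[OF assms] by (auto simp: in_V_iff pos_eq_iff)
    ultimately show ?thesis
      using True uv by (auto simp: orient_def flip_def pos_shift[OF assms])
  next
    case False
    then show ?thesis using G_sym by (auto simp: orient_def flip_def)
  qed
  then show ?thesis
    by (intro pair_pre_digraph.equality) (auto simp: orient_verts flip_def)
qed

text \<open>
  Rotating \<open>n - 1\<close> times is rotating once backwards, which flips the sink on the last seat.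
\<close>

lemma orient_shift_back:
  assumes "\<sigma> \<in> B"
  shows "orient ((shift ^^ (n - 1)) \<sigma>) = flip (\<sigma> n) (orient \<sigma>)"
proof -
  have Vn: "n \<in> V" using n_ge_2 by (simp add: in_V_iff)
  have "(u, v) \<in> parcs (orient ((shift ^^ (n - 1)) \<sigma>)) \<longleftrightarrow> (u, v) \<in> parcs (flip (\<sigma> n) (orient \<sigma>))" for u v
  proof (cases "(u, v) \<in> parcs G")
    case True
    then have uv: "u \<in> V" "v \<in> V" "u \<noteq> v" "(v, u) \<in> parcs G"
      using G_sym by (auto simp: G_arc_iff)
    have "pos \<sigma> u = n \<longleftrightarrow> u = \<sigma> n" "pos \<sigma> v = n \<longleftrightarrow> v = \<sigma> n"
      using uv assms Vn by (metis pos_value value_pos)+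
    moreover have "1 \<le> pos \<sigma> u" "pos \<sigma> u \<le> n" "1 \<le> pos \<sigma> v" "pos \<sigma> v \<le> n" "pos \<sigma> u \<noteq> pos \<sigma> v"
      using uv assms pos_in_V[OF assms] by (auto simp: in_V_iff pos_eq_iff)
    ultimately show ?thesis
      using True uv by (auto simp: orient_def flip_def pos_shift_pow[OF assms])
  next
    case False
    then show ?thesis using G_sym by (auto simp: orient_def flip_def)
  qed
  then show ?thesis
    by (intro pair_pre_digraph.equality) (auto simp: orient_verts flip_def)
qed

lemma finite_orient: "finite (parcs (orient \<sigma>))"
  by (rule finite_subset[of _ "V \<times> V"]) (auto simp: orient_def G_arc_iff)

lemma orient_in_Acyc:
  assumes "\<sigma> \<in> B"
  shows "orient \<sigma> \<in> Acyc G"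
proof -
  have "pos \<sigma> u \<noteq> pos \<sigma> v" if "(u, v) \<in> parcs G" for u v
    using that assms by (auto simp: G_arc_iff pos_eq_iff)
  then have "orientation G (orient \<sigma>)"
    using G_sym by (fastforce simp: orientation_def orient_def G_verts)
  moreover have "parcs (orient \<sigma>) \<subseteq> measure (pos \<sigma>)"
    by (auto simp: orient_def)
  then have "acyclic (parcs (orient \<sigma>))"
    by (meson acyclic_subset wf_acyclic wf_measure)
  ultimately show ?thesis by (simp add: Acyc_def)
qed

lemma linear_extension_orient:
  assumes "\<alpha> \<in> Acyc G" "\<sigma> \<in> linear_extensions n \<alpha>"
  shows "\<sigma> \<in> B" and "orient \<sigma> = \<alpha>"
proof -
  show \<sigma>: "\<sigma> \<in> B" using assms(2) by (simp add: linear_extensions_def V_def)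
  have or: "pverts \<alpha> = V" "parcs \<alpha> \<subseteq> parcs G"
    "\<And>u v. (u, v) \<in> parcs G \<Longrightarrow> (u, v) \<in> parcs \<alpha> \<longleftrightarrow> (v, u) \<notin> parcs \<alpha>"
    using assms(1) by (auto simp: Acyc_def orientation_def G_verts)
  have less: "pos \<sigma> u < pos \<sigma> v" if uv: "(u, v) \<in> parcs \<alpha>" for u v
  proof -
    have G: "u \<in> V" "v \<in> V" "u \<noteq> v" using uv or(2) by (auto simp: G_arc_iff)
    have "(u, v) \<in> rtrancl_on V (parcs \<alpha>)"
      using G uv by (meson rtrancl_on_into_rtrancl_on rtrancl_on_refl)
    then have "u \<rightarrow>\<^sup>*\<^bsub>with_proj \<alpha>\<^esub> v"
      by (simp add: reachable_def or(1))
    then have "pos \<sigma> u \<le> pos \<sigma> v"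
      using assms(2) by (simp add: linear_extensions_def pos_def V_def)
    then show ?thesis using G \<sigma> pos_eq_iff by (metis le_neq_implies_less)
  qed
  have "(u, v) \<in> parcs (orient \<sigma>) \<longleftrightarrow> (u, v) \<in> parcs \<alpha>" for u v
    using less[of u v] less[of v u] or(2) or(3)[of u v] by (auto simp: orient_arc_iff)
  then show "orient \<sigma> = \<alpha>"
    by (intro pair_pre_digraph.equality) (auto simp: or(1) orient_verts)
qed

end

lemma degree_eq_0_iff:
  assumes "finite (parcs \<alpha>)"
  shows "in_degree (with_proj \<alpha>) v = 0 \<longleftrightarrow> (\<forall>u. (u, v) \<notin> parcs \<alpha>)"
    and "out_degree (with_proj \<alpha>) v = 0 \<longleftrightarrow> (\<forall>u. (v, u) \<notin> parcs \<alpha>)"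
  using assms by (auto simp: in_degree_def out_degree_def in_arcs_def out_arcs_def)

lemma flip_rel_iff:
  assumes "finite (parcs \<alpha>)"
  shows "(\<alpha>, \<beta>) \<in> flip_rel \<longleftrightarrow> (\<exists>v \<in> pverts \<alpha>. \<beta> = flip v \<alpha> \<and>
    ((\<forall>u. (u, v) \<notin> parcs \<alpha>) \<or> (\<forall>u. (v, u) \<notin> parcs \<alpha>)))"
  by (auto simp: flip_rel_def degree_eq_0_iff[OF assms])

lemma flip_flip: "flip v (flip v \<alpha>) = \<alpha>"
  by (intro pair_pre_digraph.equality) (auto simp: flip_def)

lemma finite_flip:
  assumes "finite (parcs \<alpha>)"
  shows "finite (parcs (flip v \<alpha>))"
proof (rule finite_subset)
  show "parcs (flip v \<alpha>) \<subseteq> parcs \<alpha> \<union> (parcs \<alpha>)\<inverse>" by (auto simp: flip_def)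
qed (simp add: assms)

text \<open>
  Flipping the same vertex again undoes a flip.  Finiteness matters because the degree of a
  vertex with infinitely many arcs is \<open>0\<close> by convention.
\<close>

lemma flip_rel_sym:
  assumes "finite (parcs \<alpha>)" "(\<alpha>, \<beta>) \<in> flip_rel"
  shows "finite (parcs \<beta>)" and "(\<beta>, \<alpha>) \<in> flip_rel"
proof -
  obtain v where v: "v \<in> pverts \<alpha>" "\<beta> = flip v \<alpha>"
    "(\<forall>u. (u, v) \<notin> parcs \<alpha>) \<or> (\<forall>u. (v, u) \<notin> parcs \<alpha>)"
    using assms by (auto simp: flip_rel_iff)
  show fin: "finite (parcs \<beta>)" using assms(1) v(2) by (simp add: finite_flip)
  have "\<alpha> = flip v \<beta>" by (simp add: v(2) flip_flip)
  moreover have "v \<in> pverts \<beta>" using v by (simp add: flip_def)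
  moreover have "(\<forall>u. (u, v) \<notin> parcs \<beta>) \<or> (\<forall>u. (v, u) \<notin> parcs \<beta>)"
    using v by (auto simp: flip_def)
  ultimately show "(\<beta>, \<alpha>) \<in> flip_rel"
    unfolding flip_rel_iff[OF fin] by blast
qed

lemma flip_rel_rtrancl_sym:
  assumes "(\<alpha>, \<beta>) \<in> flip_rel\<^sup>*" "finite (parcs \<alpha>)"
  shows "finite (parcs \<beta>) \<and> (\<beta>, \<alpha>) \<in> flip_rel\<^sup>*"
  using assms
proof (induction rule: rtrancl_induct)
  case (step \<beta> \<gamma>)
  then show ?case
    using flip_rel_sym by (blast intro: converse_rtrancl_into_rtrancl)
qed simp

context friends_on_cycle
begin

lemma flip_rel_shift:
  assumes "\<sigma> \<in> B"
  shows "(orient \<sigma>, orient (shift \<sigma>)) \<in> flip_rel"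
proof -
  have V1: "1 \<in> V" using n_ge_2 by (simp add: in_V_iff)
  have "(u, \<sigma> 1) \<notin> parcs (orient \<sigma>)" for u
    using pos_value[OF assms V1] pos_in_V[OF assms, of u]
    by (auto simp: orient_def G_arc_iff in_V_iff)
  then show ?thesis
    using value_in_V[OF assms V1]
    by (auto simp: flip_rel_iff[OF finite_orient] orient_verts orient_shift[OF assms])
qed

lemma flip_equiv_shift_pow:
  assumes "\<sigma> \<in> B"
  shows "(orient \<sigma>, orient ((shift ^^ k) \<sigma>)) \<in> flip_rel\<^sup>*"
  using assms
  by (induction k) (auto intro: rtrancl_into_rtrancl flip_rel_shift shift_pow_in_B)

text \<open>
  Only the swap across the cut can change the orientation.  After one rotation it takes place on
  the seats \<open>n - 1\<close> and \<open>n\<close>, where it is harmless, and each rotation is a flip.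
\<close>

lemma joined_flip_equiv:
  assumes "\<sigma> \<frown> \<tau>"
  shows "(orient \<sigma>, orient \<tau>) \<in> flip_rel\<^sup>*"
  using assms
proof (induction rule: joined_induct)
  case (step \<rho> i)
  have not_G: "(\<rho> i, \<rho> (next_pos i)) \<notin> parcs G"
    using step.hyps by (simp add: G_arc_iff)
  have "(orient \<rho>, orient (exchange i \<rho>)) \<in> flip_rel\<^sup>*"
  proof (cases "i = n")
    case False
    then have "1 \<le> i" "i < n" "next_pos i = i + 1"
      using step.hyps by (auto simp: in_V_iff cyc_perm_def)
    then show ?thesis
      using exchange_interior(2)[OF step.hyps(2)] not_G by simp
  next
    case True
    let ?\<rho> = "exchange n \<rho>"
    have ex: "?\<rho> \<in> B" using step.hyps True by (simp add: exchange_in_B)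
    have j: "n - 1 \<in> V" "n \<in> V" "next_pos (n - 1) = n" "1 \<le> n - 1" "n - 1 < n" "n - 1 + 1 = n"
      using n_ge_2 by (auto simp: in_V_iff cyc_perm_def)
    have "shift ?\<rho> = exchange (n - 1) (shift \<rho>)"
      using shift_exchange[OF j(1)] j(3) by simp
    moreover have "(shift \<rho> (n - 1), shift \<rho> (n - 1 + 1)) \<notin> parcs G"
      using not_G True j by (simp add: shift_apply)
    ultimately have "orient (shift ?\<rho>) = orient (shift \<rho>)"
      using exchange_interior(2)[OF shift_in_B[OF step.hyps(2)] j(4,5)] by simp
    then show ?thesis
      using flip_rel_shift[OF step.hyps(2)] flip_rel_sym(2)[OF finite_orient flip_rel_shift[OF ex]] True
      by (metis r_into_rtrancl rtrancl_trans)
  qed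
  with step.IH show ?case by (rule rtrancl_trans)
qed simp

text \<open>
  Each flip is imitated on arrangements: sort the flipped source to the first seat (or the sink
  to the last one) and rotate it across the cut.
\<close>

lemma flip_equiv_imp_joined_shift:
  assumes "(orient \<sigma>, \<beta>) \<in> flip_rel\<^sup>*" "\<sigma> \<in> B"
  shows "\<exists>\<tau> k. \<tau> \<in> B \<and> orient \<tau> = \<beta> \<and> (shift ^^ k) \<sigma> \<frown> \<tau>"
  using assms(1)
proof (induction rule: rtrancl_induct)
  case base
  have "(shift ^^ 0) \<sigma> \<frown> \<sigma>" using assms(2) by (simp add: joined_refl)
  then show ?case using assms(2) by blast
next
  case (step \<beta> \<gamma>)
  then obtain \<tau> k where \<tau>: "\<tau> \<in> B" "orient \<tau> = \<beta>" "(shift ^^ k) \<sigma> \<frown> \<tau>" by blast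
  have fin: "finite (parcs \<beta>)" using \<tau>(2) finite_orient by blast
  obtain v where v: "v \<in> V" "\<gamma> = flip v \<beta>" and
    "(\<forall>u. (u, v) \<notin> parcs \<beta>) \<or> (\<forall>u. (v, u) \<notin> parcs \<beta>)"
    using step.hyps(2) \<tau>(2) orient_verts by (auto simp: flip_rel_iff[OF fin])
  then consider "\<And>u. (u, v) \<notin> parcs (orient \<tau>)" | "\<And>u. (v, u) \<notin> parcs (orient \<tau>)"
    using \<tau>(2) by blast
  then have "\<exists>\<rho> m. \<tau> \<frown> \<rho> \<and> orient ((shift ^^ m) \<rho>) = \<gamma>"
  proof cases
    case 1
    then obtain \<rho> where "\<tau> \<frown> \<rho>" "orient \<rho> = orient \<tau>" "\<rho> 1 = v"
      using source_to_front[OF \<tau>(1) v(1)] by blast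
    then have "orient ((shift ^^ 1) \<rho>) = \<gamma>"
      using orient_shift[OF joined_in_B(2)] v(2) \<tau>(2) by simp
    then show ?thesis using \<open>\<tau> \<frown> \<rho>\<close> by blast
  next
    case 2
    then obtain \<rho> where "\<tau> \<frown> \<rho>" "orient \<rho> = orient \<tau>" "\<rho> n = v"
      using sink_to_back[OF \<tau>(1) v(1)] by blast
    then have "orient ((shift ^^ (n - 1)) \<rho>) = \<gamma>"
      using orient_shift_back[OF joined_in_B(2)] v(2) \<tau>(2) by simp
    then show ?thesis using \<open>\<tau> \<frown> \<rho>\<close> by blast
  qed
  then obtain \<rho> m where \<rho>: "\<tau> \<frown> \<rho>" "orient ((shift ^^ m) \<rho>) = \<gamma>" by blast
  have "(shift ^^ (m + k)) \<sigma> \<frown> (shift ^^ m) \<rho>"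
    using joined_shift_pow[OF FS.reachable_trans[OF \<tau>(3) \<rho>(1)], of m] by (simp add: funpow_add)
  moreover have "(shift ^^ m) \<rho> \<in> B"
    using joined_in_B(2)[OF \<rho>(1)] by (rule shift_pow_in_B)
  ultimately show ?case using \<rho>(2) by blast
qed

lemma flip_equiv_iff_joined_shift:
  assumes "\<sigma> \<in> B" "\<tau> \<in> B"
  shows "(orient \<sigma>, orient \<tau>) \<in> flip_rel\<^sup>* \<longleftrightarrow> (\<exists>k. (shift ^^ k) \<sigma> \<frown> \<tau>)"
proof
  assume "(orient \<sigma>, orient \<tau>) \<in> flip_rel\<^sup>*"
  then obtain \<rho> k where "\<rho> \<in> B" "orient \<rho> = orient \<tau>" "(shift ^^ k) \<sigma> \<frown> \<rho>"
    using flip_equiv_imp_joined_shift assms(1) by blast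
  then show "\<exists>k. (shift ^^ k) \<sigma> \<frown> \<tau>"
    using same_orientation_joined assms(2) FS.reachable_trans by blast
next
  assume "\<exists>k. (shift ^^ k) \<sigma> \<frown> \<tau>"
  then obtain k where "(shift ^^ k) \<sigma> \<frown> \<tau>" by blast
  then show "(orient \<sigma>, orient \<tau>) \<in> flip_rel\<^sup>*"
    using flip_equiv_shift_pow[OF assms(1), of k] joined_flip_equiv rtrancl_trans by metis
qed

end

section \<open>Winding and the period of a component\<close>

lemma div_add_1_eq_if_not_dvd:
  fixes a m :: int
  assumes "0 < m" "\<not> m dvd a + 1"
  shows "(a + 1) div m = a div m"
proof -
  have "a mod m + 1 \<noteq> m"
  proof
    assume "a mod m + 1 = m"
    then have "(a + 1) mod m = 0" by (metis mod_add_left_eq mod_self)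
    then show False using assms(2) by (simp add: dvd_eq_mod_eq_0)
  qed
  then have "0 \<le> a mod m + 1 \<and> a mod m + 1 < m"
    using pos_mod_bound[OF assms(1), of a] pos_mod_sign[OF assms(1), of a] by linarith
  moreover have "a + 1 = (a mod m + 1) + a div m * m" by simp
  ultimately show ?thesis
    by (metis add.left_neutral assms(1) div_mult_self1 div_pos_pos_trivial less_irrefl add.commute)
qed

context friends_on_cycle
begin

lemma int_next_pos_mod: "i \<in> V \<Longrightarrow> int (next_pos i) mod int n = (int i + 1) mod int n"
  by (auto simp: cyc_perm_def add.commute)

lemma int_pos_shift_pow_mod:
  assumes "\<sigma> \<in> B" "v \<in> V"
  shows "int (pos ((shift ^^ k) \<sigma>) v) mod int n = (int (pos \<sigma> v) - int k) mod int n"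
proof (induction k)
  case (Suc k)
  let ?\<tau> = "(shift ^^ k) \<sigma>"
  have \<tau>: "?\<tau> \<in> B" using assms(1) by (rule shift_pow_in_B)
  have "int (pos (shift ?\<tau>) v) mod int n = (int (pos ?\<tau> v) - 1) mod int n"
    using pos_in_V[OF \<tau> assms(2)] by (auto simp: pos_shift[OF \<tau> assms(2)] in_V_iff of_nat_diff)
  also have "\<dots> = (int (pos \<sigma> v) - int (Suc k)) mod int n"
    using Suc.IH by (metis (no_types, lifting) diff_diff_eq mod_diff_left_eq of_nat_Suc add.commute)
  finally show ?case by simp
qed simp

text \<open>
  \<open>p\<close> records positions on the universal cover \<open>\<int>\<close> of the cycle \<open>\<int>/n\<close>.
\<close>

definition lifts :: "(nat \<Rightarrow> nat) \<Rightarrow> (nat \<Rightarrow> int) \<Rightarrow> bool" where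
  "lifts \<sigma> p \<longleftrightarrow> (\<forall>v \<in> V. p v mod int n = int (pos \<sigma> v) mod int n)"

lemma lifts_not_dvd:
  assumes "lifts \<sigma> p" "\<sigma> \<in> B" "u \<in> V" "v \<in> V" "u \<noteq> v"
  shows "\<not> int n dvd p u - p v"
proof
  assume "int n dvd p u - p v"
  then have "int (pos \<sigma> u) mod int n = int (pos \<sigma> v) mod int n"
    using assms by (simp add: lifts_def mod_eq_dvd_iff[symmetric])
  then have "int n dvd int (pos \<sigma> u) - int (pos \<sigma> v)"
    by (simp add: mod_eq_dvd_iff)
  moreover have "\<bar>int (pos \<sigma> u) - int (pos \<sigma> v)\<bar> < int n"
    using pos_in_V[OF assms(2,3)] pos_in_V[OF assms(2,4)] by (auto simp: in_V_iff)
  ultimately have "int (pos \<sigma> u) - int (pos \<sigma> v) = 0"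
    using dvd_imp_le_int[of "int (pos \<sigma> u) - int (pos \<sigma> v)" "int n"] by linarith
  then have "pos \<sigma> u = pos \<sigma> v" by simp
  then show False using assms by (simp add: pos_eq_iff)
qed

text \<open>
  A swap moves one person a step forwards and the other a step backwards, so the sum of the lifted
  positions is invariant.  For neighbours \<open>u\<close>, \<open>v\<close> in \<open>G\<close> the difference \<open>p u - p v\<close> changes by at most
  \<open>1\<close> at a time and is never a multiple of \<open>n\<close>, so it stays between the same two consecutive
  multiples of \<open>n\<close>.
\<close>

lemma joined_lift:
  assumes "\<sigma> \<frown> \<tau>"
  shows "\<exists>p. lifts \<tau> p \<and> (\<Sum>v \<in> V. p v) = (\<Sum>v \<in> V. int (pos \<sigma> v)) \<and>
    (\<forall>(u, v) \<in> parcs G. (p u - p v) div int n = (int (pos \<sigma> u) - int (pos \<sigma> v)) div int n)"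
  using assms
proof (induction rule: joined_induct)
  case base
  show ?case by (rule exI[of _ "\<lambda>v. int (pos \<sigma> v)"]) (auto simp: lifts_def)
next
  case (step \<rho> i)
  then obtain p where p: "lifts \<rho> p" "(\<Sum>v \<in> V. p v) = (\<Sum>v \<in> V. int (pos \<sigma> v))"
    and p_div: "\<And>u v. (u, v) \<in> parcs G \<Longrightarrow>
      (p u - p v) div int n = (int (pos \<sigma> u) - int (pos \<sigma> v)) div int n"
    by blast
  let ?x = "\<rho> i" and ?y = "\<rho> (next_pos i)"
  define q where "q v = p v + (if v = ?x then 1 else 0) - (if v = ?y then 1 else 0)" for v
  have V: "i \<in> V" "next_pos i \<in> V" "?x \<in> V" "?y \<in> V"
    using step.hyps next_pos_in_V by (auto simp: value_in_V)
  have xy: "?x \<noteq> ?y" using Y_irrefl[OF step.hyps(4)] .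
  have B: "exchange i \<rho> \<in> B" using step.hyps by (simp add: exchange_in_B)
  have "lifts (exchange i \<rho>) q"
    unfolding lifts_def
  proof
    fix v assume v: "v \<in> V"
    have pv: "p v mod int n = int (pos \<rho> v) mod int n" using p(1) v by (simp add: lifts_def)
    consider "v = ?x" | "v = ?y" | "v \<noteq> ?x" "v \<noteq> ?y" by blast
    then show "q v mod int n = int (pos (exchange i \<rho>) v) mod int n"
    proof cases
      case 1
      then have pos: "pos \<rho> v = i" using step.hyps V by (simp add: pos_value)
      have "q v mod int n = (int i + 1) mod int n"
        using 1 xy pv pos by (simp add: q_def) (metis mod_add_left_eq)
      then show ?thesis
        using pos v step.hyps V by (simp add: pos_exchange int_next_pos_mod)
    next
      case 2
      then have pos: "pos \<rho> v = next_pos i" using step.hyps V by (simp add: pos_value)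
      have "q v mod int n = (int (next_pos i) - 1) mod int n"
        using 2 xy pv pos by (simp add: q_def) (metis mod_diff_left_eq)
      also have "\<dots> = (int i + 1 - 1) mod int n"
        using int_next_pos_mod[OF V(1)] by (metis mod_diff_left_eq)
      finally show ?thesis
        using pos v step.hyps V next_pos_neq[OF V(1)] by (simp add: pos_exchange)
    next
      case 3
      then have "pos \<rho> v \<noteq> i" "pos \<rho> v \<noteq> next_pos i"
        using value_pos[OF step.hyps(2) v] by auto
      then show ?thesis
        using 3 pv v step.hyps V by (simp add: pos_exchange q_def)
    qed
  qed
  moreover have "(\<Sum>v \<in> V. q v) = (\<Sum>v \<in> V. int (pos \<sigma> v))"
    using p(2) V by (simp add: q_def sum.distrib sum_subtractf)
  moreover have "(q u - q v) div int n = (int (pos \<sigma> u) - int (pos \<sigma> v)) div int n"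
    if uv: "(u, v) \<in> parcs G" for u v
  proof -
    have uvV: "u \<in> V" "v \<in> V" "u \<noteq> v" using uv by (auto simp: G_arc_iff)
    have "\<not> (u = ?x \<and> v = ?y)" "\<not> (u = ?y \<and> v = ?x)"
      using uv step.hyps(4) G_sym by (auto simp: G_arc_iff)
    then have "q u - q v = p u - p v \<or> q u - q v = (p u - p v) + 1 \<or> p u - p v = (q u - q v) + 1"
      using uvV(3) xy by (simp add: q_def)
    then consider "q u - q v = p u - p v" | "q u - q v = (p u - p v) + 1" | "p u - p v = (q u - q v) + 1"
      by blast
    \<comment> \<open>distinct people occupy distinct seats, both before and after the swap\<close>
    moreover have "\<not> int n dvd p u - p v" "\<not> int n dvd q u - q v"
      using lifts_not_dvd[OF p(1) step.hyps(2)] lifts_not_dvd[OF \<open>lifts (exchange i \<rho>) q\<close> B] uvV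
      by auto
    ultimately have "(q u - q v) div int n = (p u - p v) div int n"
      using n_ge_2 by cases (auto simp: div_add_1_eq_if_not_dvd)
    then show ?thesis using p_div[OF uv] by simp
  qed
  ultimately show ?case by blast
qed

definition component_gcd :: nat where
  "component_gcd = Gcd {card (verts C) | C. C \<in> conn_components (with_proj G)}"

abbreviation G_class :: "nat \<Rightarrow> nat set" where
  "G_class v \<equiv> {w. v \<rightarrow>\<^sup>*\<^bsub>with_proj G\<^esub> w}"

lemma component_gcd_eq: "component_gcd = (GCD v \<in> V. card (G_class v))"
proof -
  have "{card (verts C) | C. C \<in> conn_components (with_proj G)} = (\<lambda>v. card (G_class v)) ` V"
    unfolding G.conn_components_eq_reachable_classes with_proj_simps G_verts
    by (auto simp: image_iff) (metis induce_subgraph_verts)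
  then show ?thesis by (simp add: component_gcd_def)
qed

lemma G_class_subset: "G_class v \<subseteq> V"
  using G.reachable_in_verts(2) by (auto simp: G_verts)

lemma G_class_closed: "(u, w) \<in> parcs G \<Longrightarrow> u \<in> G_class v \<longleftrightarrow> w \<in> G_class v"
  using G_sym G.reachable_adj_trans by (metis mem_Collect_eq with_proj_simps(3))

lemma component_gcd_pos: "0 < component_gcd"
proof -
  have V1: "1 \<in> V" using n_ge_2 by (simp add: in_V_iff)
  then have "1 \<in> G_class 1" using G.reachable_refl[of 1] by (simp add: G_verts)
  then have "0 < card (G_class 1)"
    using finite_subset[OF G_class_subset finite_V] by (auto simp: card_gt_0_iff)
  moreover have "component_gcd dvd card (G_class 1)"
    unfolding component_gcd_eq using V1 by (intro Gcd_dvd) auto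
  ultimately show ?thesis by (metis dvd_0_left_iff neq0_conv)
qed

text \<open>
  A function that is constant on each component of \<open>G\<close> sums to an integer combination of the
  component sizes.
\<close>

lemma component_gcd_dvd_sum:
  fixes w :: "nat \<Rightarrow> int"
  assumes "\<And>u v. (u, v) \<in> parcs G \<Longrightarrow> w u = w v"
  shows "int component_gcd dvd (\<Sum>v \<in> V. w v)"
proof -
  have const: "w u = w v" if "v \<rightarrow>\<^sup>*\<^bsub>with_proj G\<^esub> u" for u v
    using that by (induction rule: G.reachable_induct) (use assms in auto)
  have V_eq: "V = \<Union> (G_class ` V)"
    using G_class_subset G.reachable_refl by (force simp: G_verts)
  have "(\<Sum>v \<in> V. w v) = (\<Sum>v \<in> \<Union> (G_class ` V). w v)"
    using V_eq by simp
  also have "\<dots> = (\<Sum>C \<in> G_class ` V. \<Sum>v \<in> C. w v)"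
  proof (subst sum.Union_disjoint)
    show "\<forall>C \<in> G_class ` V. finite C"
      using finite_subset[OF G_class_subset finite_V] by auto
    show "\<forall>C \<in> G_class ` V. \<forall>D \<in> G_class ` V. C \<noteq> D \<longrightarrow> C \<inter> D = {}"
    proof (clarify, rule ccontr)
      fix u v assume ne: "G_class u \<noteq> G_class v" and "G_class u \<inter> G_class v \<noteq> {}"
      then obtain x where "u \<rightarrow>\<^sup>*\<^bsub>with_proj G\<^esub> x" "v \<rightarrow>\<^sup>*\<^bsub>with_proj G\<^esub> x" by blast
      then have "G_class u = G_class v"
        by (blast intro: G.reachable_trans G.symmetric_reachable')
      then show False using ne by simp
    qed
  qed simp
  also have "int component_gcd dvd \<dots>"
  proof (rule dvd_sum)
    fix C assume "C \<in> G_class ` V"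
    then obtain v where v: "v \<in> V" "C = G_class v" by blast
    have "(\<Sum>u \<in> C. w u) = (\<Sum>u \<in> C. w v)"
      using const v by (intro sum.cong) auto
    also have "\<dots> = int (card C) * w v" by simp
    also have "component_gcd dvd card C"
      unfolding component_gcd_eq v(2) using v(1) by (intro Gcd_dvd) auto
    then have "int component_gcd dvd int (card C) * w v" by simp
    finally show "int component_gcd dvd (\<Sum>u \<in> C. w u)" .
  qed
  finally show ?thesis .
qed

text \<open>
  After a walk to the rotation by \<open>k\<close>, the person \<open>v\<close> sits at \<open>pos \<sigma> v - k + n * w v\<close> on the
  universal cover.  The winding numbers \<open>w\<close> agree on neighbours in \<open>G\<close>, and the invariance of the
  sum of positions forces \<open>n * (\<Sum>v. w v) = n * k\<close>.
\<close>

lemma component_gcd_dvd_period: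
  assumes "(shift ^^ k) \<sigma> \<frown> \<sigma>"
  shows "component_gcd dvd k"
proof -
  have \<sigma>: "\<sigma> \<in> B" using joined_in_B(2)[OF assms] .
  obtain p where p: "lifts ((shift ^^ k) \<sigma>) p" "(\<Sum>v \<in> V. p v) = (\<Sum>v \<in> V. int (pos \<sigma> v))"
    and p_div: "\<And>u v. (u, v) \<in> parcs G \<Longrightarrow>
      (p u - p v) div int n = (int (pos \<sigma> u) - int (pos \<sigma> v)) div int n"
    using joined_lift[OF joined_sym[OF assms]] by blast
  have "\<exists>w. p v = int (pos \<sigma> v) - int k + int n * w" if "v \<in> V" for v
  proof -
    have "p v mod int n = (int (pos \<sigma> v) - int k) mod int n"
      using p(1) that int_pos_shift_pow_mod[OF \<sigma> that] by (simp add: lifts_def)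
    then have "int n dvd p v - (int (pos \<sigma> v) - int k)"
      by (simp add: mod_eq_dvd_iff)
    then obtain w where "p v - (int (pos \<sigma> v) - int k) = int n * w" ..
    then show ?thesis by (intro exI[of _ w]) linarith
  qed
  then obtain w where w: "\<And>v. v \<in> V \<Longrightarrow> p v = int (pos \<sigma> v) - int k + int n * w v"
    by metis
  have "w u = w v" if uv: "(u, v) \<in> parcs G" for u v
  proof -
    have uvV: "u \<in> V" "v \<in> V" using uv by (auto simp: G_arc_iff)
    let ?D = "int (pos \<sigma> u) - int (pos \<sigma> v)"
    have "p u - p v = ?D + int n * (w u - w v)"
      unfolding w[OF uvV(1)] w[OF uvV(2)] by (simp add: algebra_simps)
    then have "?D div int n = (?D + int n * (w u - w v)) div int n"
      using p_div[OF uv] by simp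
    also have "\<dots> = ?D div int n + (w u - w v)"
      using n_ge_2 by (simp add: div_mult_self2)
    finally show ?thesis by simp
  qed
  then have "int component_gcd dvd (\<Sum>v \<in> V. w v)"
    by (rule component_gcd_dvd_sum)
  moreover have "(\<Sum>v \<in> V. w v) = int k"
  proof -
    have "(\<Sum>v \<in> V. p v) = (\<Sum>v \<in> V. int (pos \<sigma> v) - int k + int n * w v)"
      using w by (intro sum.cong) auto
    also have "\<dots> = (\<Sum>v \<in> V. int (pos \<sigma> v)) - int n * int k + int n * (\<Sum>v \<in> V. w v)"
      by (simp add: sum.distrib sum_subtractf sum_distrib_left V_def)
    finally have "int n * (\<Sum>v \<in> V. w v) = int n * int k"
      using p(2) by linarith
    then show ?thesis using n_ge_2 by simp
  qed
  ultimately show ?thesis by simp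
qed

lemma joined_shift_pow_mult:
  assumes "(shift ^^ d) \<sigma> \<frown> \<sigma>"
  shows "(shift ^^ (d * q)) \<sigma> \<frown> \<sigma>"
proof (induction q)
  case 0
  then show ?case using joined_refl[OF joined_in_B(2)[OF assms]] by simp
next
  case (Suc q)
  have "(shift ^^ (d * Suc q)) \<sigma> = (shift ^^ d) ((shift ^^ (d * q)) \<sigma>)"
    by (simp add: funpow_add)
  then show ?case
    using FS.reachable_trans[OF joined_shift_pow[OF Suc.IH, of d] assms] by simp
qed

text \<open>
  The least positive period divides every period, in particular every component size, hence also
  their greatest common divisor.
\<close>

lemma component_gcd_period:
  assumes "\<sigma> \<in> B"
  shows "(shift ^^ component_gcd) \<sigma> \<frown> \<sigma>"
proof -
  let ?P = "\<lambda>d. 0 < d \<and> (shift ^^ d) \<sigma> \<frown> \<sigma>"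
  define d where "d = (LEAST d. ?P d)"
  have "?P n" using n_ge_2 by (simp add: shift_pow_n[OF assms] joined_refl[OF assms])
  then have d: "?P d" unfolding d_def by (rule LeastI)
  have "d dvd k" if k: "(shift ^^ k) \<sigma> \<frown> \<sigma>" for k
  proof -
    have "(shift ^^ k) \<sigma> = (shift ^^ (k mod d)) ((shift ^^ (d * (k div d))) \<sigma>)"
      by (metis comp_apply funpow_add mod_mult_div_eq)
    moreover have "(shift ^^ (k mod d)) ((shift ^^ (d * (k div d))) \<sigma>) \<frown> (shift ^^ (k mod d)) \<sigma>"
      using d by (intro joined_shift_pow joined_shift_pow_mult) simp
    ultimately have "(shift ^^ (k mod d)) \<sigma> \<frown> \<sigma>"
      using k joined_sym FS.reachable_trans by metis
    then have "\<not> 0 < k mod d"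
      using d not_less_Least[of "k mod d" ?P] by (auto simp: d_def[symmetric])
    then show ?thesis by (simp add: dvd_eq_mod_eq_0)
  qed
  moreover have "(shift ^^ card (G_class v)) \<sigma> \<frown> \<sigma>" for v
    using assms G_class_subset G_class_closed by (rule component_rotation_joined)
  ultimately have "d dvd component_gcd"
    unfolding component_gcd_eq by (intro Gcd_greatest) auto
  then show ?thesis
    using d joined_shift_pow_mult by (auto elim!: dvdE)
qed

lemma joined_shift_cancel:
  assumes "\<sigma> \<in> B" "\<tau> \<in> B" "(shift ^^ k) \<sigma> \<frown> (shift ^^ k) \<tau>"
  shows "\<sigma> \<frown> \<tau>"
  using assms(3)
proof (induction k)
  case (Suc k)
  then have "(shift ^^ (n - 1)) (shift ((shift ^^ k) \<sigma>)) \<frown> (shift ^^ (n - 1)) (shift ((shift ^^ k) \<tau>))"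
    by (intro joined_shift_pow) simp
  then show ?case
    using Suc.IH shift_pow_inverse[OF shift_pow_in_B] assms by metis
qed simp

lemma joined_shift_pow_mod:
  assumes "\<sigma> \<in> B"
  shows "(shift ^^ k) \<sigma> \<frown> (shift ^^ (k mod component_gcd)) \<sigma>"
proof -
  have "(shift ^^ k) \<sigma> =
      (shift ^^ (k mod component_gcd)) ((shift ^^ (component_gcd * (k div component_gcd))) \<sigma>)"
    by (metis comp_apply funpow_add mod_mult_div_eq)
  then show ?thesis
    using joined_shift_pow[OF joined_shift_pow_mult[OF component_gcd_period[OF assms]]] by metis
qed

lemma joined_shift_pow_inj:
  assumes "\<sigma> \<in> B" "(shift ^^ k) \<sigma> \<frown> (shift ^^ l) \<sigma>" "k < component_gcd" "l < component_gcd"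
  shows "k = l"
proof -
  have aux: "k = l" if j: "(shift ^^ k) \<sigma> \<frown> (shift ^^ l) \<sigma>" and "l \<le> k" "k < component_gcd" for k l
  proof -
    have "(shift ^^ k) \<sigma> = (shift ^^ l) ((shift ^^ (k - l)) \<sigma>)"
      using that(2) by (metis comp_apply funpow_add le_add_diff_inverse)
    then have "(shift ^^ (k - l)) \<sigma> \<frown> \<sigma>"
      using j joined_shift_cancel[OF shift_pow_in_B[OF assms(1)] assms(1)] by metis
    then have "component_gcd dvd k - l" by (rule component_gcd_dvd_period)
    then show ?thesis using that by (auto dest: dvd_imp_le)
  qed
  show ?thesis
    using aux[of k l] aux[of l k] assms joined_sym by (metis nle_le)
qed

end

section \<open>Decomposition into components\<close>

context friends_on_cycle
begin

abbreviation FS_class :: "(nat \<Rightarrow> nat) \<Rightarrow> (nat \<Rightarrow> nat) set" where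
  "FS_class \<sigma> \<equiv> {\<tau>. \<sigma> \<frown> \<tau>}"

lemma component_of_FS:
  "\<sigma> \<in> B \<Longrightarrow> component_of (FS_cycle n Y) \<sigma> = FS_cycle n Y \<restriction> FS_class \<sigma>"
  by (rule FS.component_of_eq) (simp add: FS_verts)

lemma shift_FS_class:
  assumes "\<sigma> \<in> B"
  shows "shift ` FS_class \<sigma> = FS_class (shift \<sigma>)"
proof (intro equalityI subsetI)
  fix \<tau> assume "\<tau> \<in> FS_class (shift \<sigma>)"
  then have \<tau>: "shift \<sigma> \<frown> \<tau>" by simp
  have "(shift ^^ (n - 1)) (shift \<sigma>) \<frown> (shift ^^ (n - 1)) \<tau>"
    using \<tau> by (rule joined_shift_pow)
  then have "\<sigma> \<frown> (shift ^^ (n - 1)) \<tau>"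
    by (simp only: shift_pow_inverse[OF assms])
  moreover have "\<tau> = shift ((shift ^^ (n - 1)) \<tau>)"
    using shift_pow_inverse[OF joined_in_B(2)[OF \<tau>]] by (simp only: funpow_swap1)
  ultimately show "\<tau> \<in> shift ` FS_class \<sigma>" by blast
qed (auto dest: joined_shift)

lemma cyc_shift_graph_pow_component:
  assumes "\<sigma> \<in> B"
  shows "(cyc_shift_graph n Y ^^ k) (FS_cycle n Y \<restriction> FS_class \<sigma>) =
    FS_cycle n Y \<restriction> FS_class ((shift ^^ k) \<sigma>)"
proof (induction k)
  case (Suc k)
  then show ?case
    by (simp add: cyc_shift_graph_def shift_FS_class shift_pow_in_B[OF assms])
qed simp

text \<open>
  The isomorphism is \<open>shift\<close> itself, restricted to the component.
\<close>

lemma component_iso_shift: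
  assumes "\<sigma> \<in> B"
  shows "digraph_iso (FS_cycle n Y \<restriction> FS_class \<sigma>) (FS_cycle n Y \<restriction> FS_class (shift \<sigma>))"
proof -
  let ?H = "FS_cycle n Y \<restriction> FS_class \<sigma>" and ?K = "FS_cycle n Y \<restriction> FS_class (shift \<sigma>)"
  let ?iso = "\<lparr> iso_verts = shift, iso_arcs = map_prod shift shift, iso_head = snd, iso_tail = fst \<rparr>"
  have sub: "FS_class \<sigma> \<subseteq> B" using joined_in_B(2) by blast
  interpret H: wf_digraph ?H by (rule FS.wellformed_induce_subgraph)
  have "inj_on shift (FS_class \<sigma>)"
    using shift_inj_on sub by (rule inj_on_subset)
  moreover have "inj_on (map_prod shift shift) (arcs ?H)"
    using map_prod_inj_on[OF calculation calculation] by (rule inj_on_subset) auto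
  ultimately have "pre_digraph.digraph_isomorphism ?H ?iso"
    using H.wf_digraph by (simp add: pre_digraph.digraph_isomorphism_def)
  moreover have "?K = app_iso ?iso ?H"
  proof (rule pre_digraph.equality)
    show "arcs ?K = arcs (app_iso ?iso ?H)"
    proof (intro equalityI subsetI)
      fix e assume e: "e \<in> arcs ?K"
      then obtain \<rho> \<tau> where "e = (\<rho>, \<tau>)" "\<rho> \<in> shift ` FS_class \<sigma>" "\<tau> \<in> shift ` FS_class \<sigma>"
        unfolding shift_FS_class[OF assms] by (cases e) auto
      then obtain \<rho>' \<tau>' where e': "e = (shift \<rho>', shift \<tau>')" "\<sigma> \<frown> \<rho>'" "\<sigma> \<frown> \<tau>'"
        by blast
      then have "(\<rho>', \<tau>') \<in> arcs ?H"
        using e FS_arc_shift_iff[of \<rho>' \<tau>'] joined_in_B(2) by simp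
      then show "e \<in> arcs (app_iso ?iso ?H)"
        using e'(1) by (auto intro!: image_eqI[of _ _ "(\<rho>', \<tau>')"])
    next
      fix e assume "e \<in> arcs (app_iso ?iso ?H)"
      then show "e \<in> arcs ?K"
        by (auto intro: FS_arc_shift joined_shift)
    qed
  qed (simp_all add: shift_FS_class[OF assms])
  ultimately show ?thesis unfolding digraph_iso_def by blast
qed

lemma component_iso_shift_pow:
  assumes "\<sigma> \<in> B"
  shows "digraph_iso (FS_cycle n Y \<restriction> FS_class \<sigma>) (FS_cycle n Y \<restriction> FS_class ((shift ^^ k) \<sigma>))"
proof (induction k)
  case 0
  let ?H = "FS_cycle n Y \<restriction> FS_class \<sigma>"
  have "wf_digraph ?H" by (rule FS.wellformed_induce_subgraph)
  then show ?case
    unfolding digraph_iso_def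
    by (intro exI[of _ "\<lparr> iso_verts = id, iso_arcs = id, iso_head = snd, iso_tail = fst \<rparr>"])
      (auto simp: pre_digraph.digraph_isomorphism_def intro!: pre_digraph.equality)
next
  case (Suc k)
  then show ?case
    using digraph_iso_trans component_iso_shift[OF shift_pow_in_B[OF assms]] by fastforce
qed

lemma toric_rel_equiv: "equiv (Acyc G) (toric_rel G)"
proof (rule equivI)
  have "finite (parcs \<alpha>)" if "\<alpha> \<in> Acyc G" for \<alpha>
  proof (rule finite_subset)
    show "parcs \<alpha> \<subseteq> V \<times> V"
      using that by (auto simp: Acyc_def orientation_def G_arc_iff)
  qed simp
  then show "sym (toric_rel G)"
    using flip_rel_rtrancl_sym by (auto simp: toric_rel_def sym_def)
qed (auto simp: toric_rel_def refl_on_def trans_def)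

text \<open>
  A linear extension of a toric class determines the class, because the orientation that it
  extends is the one that it induces.
\<close>

lemma toric_class_eq_iff:
  assumes "T \<in> toric_acyclic_orientations G" "\<sigma> \<in> toric_linear_extensions n T"
  shows "\<sigma> \<in> B" and "\<tau> \<in> B \<Longrightarrow> (orient \<sigma>, orient \<tau>) \<in> flip_rel\<^sup>* \<longleftrightarrow> T = toric_rel G `` {orient \<tau>}"
proof -
  obtain \<alpha> where \<alpha>: "\<alpha> \<in> T" "\<sigma> \<in> linear_extensions n \<alpha>"
    using assms(2) by (auto simp: toric_linear_extensions_def)
  have T: "T \<in> Acyc G // toric_rel G"
    using assms(1) by (simp add: toric_acyclic_orientations_def)
  have "\<alpha> \<in> Acyc G"
    using \<alpha>(1) T in_quotient_imp_subset[OF toric_rel_equiv] by blast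
  note lin = linear_extension_orient[OF this \<alpha>(2)]
  show \<sigma>: "\<sigma> \<in> B" by (rule lin(1))
  have T_eq: "T = toric_rel G `` {orient \<sigma>}"
    using \<alpha>(1) T toric_rel_equiv lin(2) by (metis Image_singleton_iff equiv_class_eq quotientE)
  show "(orient \<sigma>, orient \<tau>) \<in> flip_rel\<^sup>* \<longleftrightarrow> T = toric_rel G `` {orient \<tau>}" if "\<tau> \<in> B"
    unfolding T_eq using eq_equiv_class_iff[OF toric_rel_equiv orient_in_Acyc[OF \<sigma>] orient_in_Acyc[OF that]]
      orient_in_Acyc[OF \<sigma>] orient_in_Acyc[OF that]
    by (simp add: toric_rel_def)
qed

lemma orient_toric_class:
  "\<sigma> \<in> B \<Longrightarrow> toric_rel G `` {orient \<sigma>} \<in> toric_acyclic_orientations G"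
  unfolding toric_acyclic_orientations_def by (intro quotientI orient_in_Acyc)

text \<open>
  A class met by two members of the family determines \<open>T\<close> through its toric orientation and then
  \<open>k\<close> through the period; every arrangement is reached from the chosen extension of its own toric
  class by a rotation, which may be reduced modulo the period.
\<close>

lemma shifted_classes_disjoint_cover:
  assumes ext: "\<And>T. T \<in> toric_acyclic_orientations G \<Longrightarrow> \<sigma> T \<in> toric_linear_extensions n T"
  shows "disjoint_family_on (\<lambda>(T, k). FS_class ((shift ^^ k) (\<sigma> T)))
      (toric_acyclic_orientations G \<times> {..<component_gcd})"
    and "(\<Union>(T, k) \<in> toric_acyclic_orientations G \<times> {..<component_gcd}.
      FS_class ((shift ^^ k) (\<sigma> T))) = B"
proof -
  let ?\<T> = "toric_acyclic_orientations G"
  have B: "\<sigma> T \<in> B" if "T \<in> ?\<T>" for T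
    using toric_class_eq_iff(1)[OF that ext[OF that]] .
  have class_iff: "T = toric_rel G `` {orient \<tau>} \<longleftrightarrow> (\<exists>k. (shift ^^ k) (\<sigma> T) \<frown> \<tau>)"
    if "T \<in> ?\<T>" "\<tau> \<in> B" for T \<tau>
    using toric_class_eq_iff(2)[OF that(1) ext[OF that(1)] that(2)]
      flip_equiv_iff_joined_shift[OF B[OF that(1)] that(2)] by simp
  show "disjoint_family_on (\<lambda>(T, k). FS_class ((shift ^^ k) (\<sigma> T))) (?\<T> \<times> {..<component_gcd})"
  proof -
    have "T = T' \<and> k = k'"
      if T: "T \<in> ?\<T>" "T' \<in> ?\<T>" and k: "k < component_gcd" "k' < component_gcd"
        and \<tau>: "(shift ^^ k) (\<sigma> T) \<frown> \<tau>" "(shift ^^ k') (\<sigma> T') \<frown> \<tau>" for T T' k k' \<tau>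
    proof
      show eq: "T = T'"
        using class_iff[OF T(1) joined_in_B(2)[OF \<tau>(1)]] class_iff[OF T(2) joined_in_B(2)[OF \<tau>(1)]] \<tau>
        by blast
      have "(shift ^^ k) (\<sigma> T) \<frown> (shift ^^ k') (\<sigma> T)"
        using \<tau> joined_sym FS.reachable_trans eq by metis
      then show "k = k'" using k by (intro joined_shift_pow_inj[OF B[OF T(1)]])
    qed
    note unique = this
    show ?thesis
      unfolding disjoint_family_on_def
    proof (intro ballI impI, rule ccontr)
      fix a b
      assume a: "a \<in> ?\<T> \<times> {..<component_gcd}" and b: "b \<in> ?\<T> \<times> {..<component_gcd}" and "a \<noteq> b"
        and ne: "(case a of (T, k) \<Rightarrow> FS_class ((shift ^^ k) (\<sigma> T))) \<inter>
          (case b of (T, k) \<Rightarrow> FS_class ((shift ^^ k) (\<sigma> T))) \<noteq> {}"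
      from a b obtain T k T' k' where ab: "a = (T, k)" "b = (T', k')"
        and T: "T \<in> ?\<T>" "T' \<in> ?\<T>" "k < component_gcd" "k' < component_gcd"
        by blast
      from ne obtain \<tau> where "(shift ^^ k) (\<sigma> T) \<frown> \<tau>" "(shift ^^ k') (\<sigma> T') \<frown> \<tau>"
        by (auto simp: ab)
      then show False using unique[OF T] ab \<open>a \<noteq> b\<close> by blast
    qed
  qed
  show "(\<Union>(T, k) \<in> ?\<T> \<times> {..<component_gcd}. FS_class ((shift ^^ k) (\<sigma> T))) = B"
  proof (intro equalityI subsetI)
    fix \<tau> assume \<tau>: "\<tau> \<in> B"
    let ?T = "toric_rel G `` {orient \<tau>}"
    have T: "?T \<in> ?\<T>" using orient_toric_class[OF \<tau>] .
    then obtain j where "(shift ^^ j) (\<sigma> ?T) \<frown> \<tau>" using class_iff[OF T \<tau>] by blast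
    then have "(shift ^^ (j mod component_gcd)) (\<sigma> ?T) \<frown> \<tau>"
      using joined_shift_pow_mod[OF B[OF T], of j] joined_sym FS.reachable_trans by metis
    moreover have "j mod component_gcd < component_gcd" using component_gcd_pos by simp
    ultimately show "\<tau> \<in> (\<Union>(T, k) \<in> ?\<T> \<times> {..<component_gcd}. FS_class ((shift ^^ k) (\<sigma> T)))"
      using T by (intro UN_I[of "(?T, j mod component_gcd)"]) auto
  qed (auto dest: joined_in_B(2))
qed

end

theorem theorem4p7:
  fixes n \<nu> :: nat
    and Y :: "nat pair_pre_digraph"
    and \<sigma> :: "nat pair_pre_digraph set \<Rightarrow> (nat \<Rightarrow> nat)"
    and J :: "nat pair_pre_digraph set \<Rightarrow>
      (nat \<Rightarrow> nat, (nat \<Rightarrow> nat) \<times> (nat \<Rightarrow> nat)) pre_digraph"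
  assumes "n \<ge> 2"
    and "pair_graph Y" and "pverts Y = {1..n}"
    and "\<nu> = Gcd {card (verts C) | C. C \<in> conn_components (with_proj (complement_graph Y))}"
    and "\<And>T. T \<in> toric_acyclic_orientations (complement_graph Y) \<Longrightarrow>
           \<sigma> T \<in> toric_linear_extensions n T"
    and "\<And>T. T \<in> toric_acyclic_orientations (complement_graph Y) \<Longrightarrow>
           J T = component_of (FS_cycle n Y) (\<sigma> T)"
  shows "(\<forall>T \<in> toric_acyclic_orientations (complement_graph Y).
           (\<forall>k < \<nu>. (cyc_shift_graph n Y ^^ k) (J T) \<in> conn_components (FS_cycle n Y)) \<and>
           inj_on (\<lambda>k. (cyc_shift_graph n Y ^^ k) (J T)) {..<\<nu>} \<and>
           (\<forall>k < \<nu>. \<forall>l < \<nu>.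
              digraph_iso ((cyc_shift_graph n Y ^^ k) (J T)) ((cyc_shift_graph n Y ^^ l) (J T)))) \<and>
         is_disjoint_union (FS_cycle n Y)
           (toric_acyclic_orientations (complement_graph Y) \<times> {..<\<nu>})
           (\<lambda>(T, k). (cyc_shift_graph n Y ^^ k) (J T))"
proof -
  interpret friends_on_cycle n Y
    by (rule friends_on_cycle.intro) (rule assms)+
  let ?\<T> = "toric_acyclic_orientations G"
  let ?X = "FS_cycle n Y"
  have \<nu>: "\<nu> = component_gcd" using assms(4) by (simp add: component_gcd_def)
  have B: "\<sigma> T \<in> B" if "T \<in> ?\<T>" for T
    using toric_class_eq_iff(1)[OF that assms(5)[OF that]] .
  have J: "(cyc_shift_graph n Y ^^ k) (J T) = ?X \<restriction> FS_class ((shift ^^ k) (\<sigma> T))"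
    if "T \<in> ?\<T>" for T k
    by (simp only: assms(6)[OF that] component_of_FS[OF B[OF that]]
        cyc_shift_graph_pow_component[OF B[OF that]])
  note classes = shifted_classes_disjoint_cover[of \<sigma>, OF assms(5), folded \<nu>]
  have "(cyc_shift_graph n Y ^^ k) (J T) \<in> conn_components ?X" if "T \<in> ?\<T>" for T k
    unfolding J[OF that]
    by (rule FS.reachable_class_in_conn_components) (simp add: FS_verts shift_pow_in_B[OF B[OF that]])
  moreover have "inj_on (\<lambda>k. (cyc_shift_graph n Y ^^ k) (J T)) {..<\<nu>}" if T: "T \<in> ?\<T>" for T
  proof (rule inj_onI)
    fix k l assume kl: "k \<in> {..<\<nu>}" "l \<in> {..<\<nu>}"
      and "(cyc_shift_graph n Y ^^ k) (J T) = (cyc_shift_graph n Y ^^ l) (J T)"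
    then have "FS_class ((shift ^^ k) (\<sigma> T)) = FS_class ((shift ^^ l) (\<sigma> T))"
      unfolding J[OF T] by (metis induce_subgraph_verts)
    then have "(shift ^^ k) (\<sigma> T) \<frown> (shift ^^ l) (\<sigma> T)"
      using joined_refl[OF shift_pow_in_B[OF B[OF T]]] by blast
    then show "k = l"
      using kl by (intro joined_shift_pow_inj[OF B[OF T]]) (simp_all add: \<nu>)
  qed
  moreover have "digraph_iso ((cyc_shift_graph n Y ^^ k) (J T)) ((cyc_shift_graph n Y ^^ l) (J T))"
    if T: "T \<in> ?\<T>" for T k l
    unfolding J[OF T]
    using component_iso_shift_pow[OF B[OF T]] digraph_iso_swap digraph_iso_trans
      FS.wellformed_induce_subgraph by blast
  moreover have "is_disjoint_union ?X (?\<T> \<times> {..<\<nu>}) (\<lambda>(T, k). (cyc_shift_graph n Y ^^ k) (J T))"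
    unfolding is_disjoint_union_def
  proof
    show "disjoint_family_on (\<lambda>i. verts (case i of (T, k) \<Rightarrow> (cyc_shift_graph n Y ^^ k) (J T)))
        (?\<T> \<times> {..<\<nu>})"
      using classes(1) by (auto simp: disjoint_family_on_def J)
    show "?X = FS.Union ((\<lambda>(T, k). (cyc_shift_graph n Y ^^ k) (J T)) ` (?\<T> \<times> {..<\<nu>}))"
    proof (rule pre_digraph.equality)
      have verts: "verts ((cyc_shift_graph n Y ^^ k) (J T)) = FS_class ((shift ^^ k) (\<sigma> T))"
        if "T \<in> ?\<T>" for T k
        by (simp add: J[OF that])
      show "verts ?X = verts (FS.Union ((\<lambda>(T, k). (cyc_shift_graph n Y ^^ k) (J T)) ` (?\<T> \<times> {..<\<nu>})))"
      proof -
        have "verts (FS.Union ((\<lambda>(T, k). (cyc_shift_graph n Y ^^ k) (J T)) ` (?\<T> \<times> {..<\<nu>}))) =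
            (\<Union>(T, k) \<in> ?\<T> \<times> {..<\<nu>}. verts ((cyc_shift_graph n Y ^^ k) (J T)))"
          by (simp add: FS.Union_def case_prod_unfold)
        also have "\<dots> = (\<Union>(T, k) \<in> ?\<T> \<times> {..<\<nu>}. FS_class ((shift ^^ k) (\<sigma> T)))"
          by (rule SUP_cong) (auto simp: verts)
        also have "\<dots> = B" by (rule classes(2))
        finally show ?thesis by (simp only: with_proj_simps FS_verts)
      qed
      show "arcs ?X = arcs (FS.Union ((\<lambda>(T, k). (cyc_shift_graph n Y ^^ k) (J T)) ` (?\<T> \<times> {..<\<nu>})))"
      proof (intro equalityI subsetI)
        fix e assume e: "e \<in> arcs ?X"
        then obtain \<tau> \<rho> where \<tau>\<rho>: "e = (\<tau>, \<rho>)" "(\<tau>, \<rho>) \<in> parcs (FS (cycle_graph n) Y)"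
          by (cases e) simp
        then have "\<tau> \<in> B" by (simp add: FS_arc_iff)
        then obtain T k where Tk: "T \<in> ?\<T>" "k < \<nu>" "(shift ^^ k) (\<sigma> T) \<frown> \<tau>"
          using classes(2) by blast
        then have "(shift ^^ k) (\<sigma> T) \<frown> \<rho>"
          using FS.reachable_adj_trans \<tau>\<rho>(2) by (metis with_proj_simps(3))
        then have "e \<in> arcs ((cyc_shift_graph n Y ^^ k) (J T))"
          using Tk \<tau>\<rho> by (simp add: J)
        moreover have "(cyc_shift_graph n Y ^^ k) (J T) \<in>
            (\<lambda>(T, k). (cyc_shift_graph n Y ^^ k) (J T)) ` (?\<T> \<times> {..<\<nu>})"
          using Tk by (intro image_eqI[of _ _ "(T, k)"]) auto
        ultimately show "e \<in> arcs (FS.Union ((\<lambda>(T, k). (cyc_shift_graph n Y ^^ k) (J T)) ` (?\<T> \<times> {..<\<nu>})))"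
          unfolding FS.Union_def pre_digraph.select_convs by (rule UN_I[rotated])
      next
        fix e assume "e \<in> arcs (FS.Union ((\<lambda>(T, k). (cyc_shift_graph n Y ^^ k) (J T)) ` (?\<T> \<times> {..<\<nu>})))"
        then show "e \<in> arcs ?X" by (auto simp: FS.Union_def J)
      qed
    qed (simp_all add: FS.Union_def)
  qed
  ultimately show ?thesis by blast
qed

end
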